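(* For each $n\ge0$, the group of transformations of $\mathcal C_n$ generated by all maps $\Phi_p:(X,Y)\mapsto(X+p'(Y),Y)$ and $\Psi_q:(X,Y)\mapsto(X,Y-q'(X))$, $p,q\in\mathbb C[z]$, acts transitively on $\mathcal C_n$.
   Context: $\mathcal C_n$ is the set of conjugacy classes (under simultaneous conjugation by $GL_n(\mathbb C)$) of pairs $(X,Y)$ of complex $n\times n$ matrices such that $[X,Y]-I$ has rank at most $1$. The maps $\Phi_p,\Psi_q$ are well defined on conjugacy classes and preserve the rank condition. *)

theory Defs
  imports "Jordan_Normal_Form.Matrix" "Jordan_Normal_Form.DL_Rank" "HOL-Computational_Algebra.Polynomial"
begin

definition mat_poly_eval :: "nat \<Rightarrow> complex poly \<Rightarrow> complex mat \<Rightarrow> complex mat" where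
  "mat_poly_eval n p A =
     foldr (\<lambda>i M. coeff p i \<cdot>\<^sub>m (A ^\<^sub>m i) + M) [0..<Suc (degree p)] (0\<^sub>m n n)"

text \<open>Calogero--Moser space (as a set of pairs, before quotienting by conjugation):
  pairs of n x n complex matrices with rank([X,Y] - I) at most 1.\<close>
definition CM_pairs :: "nat \<Rightarrow> (complex mat \<times> complex mat) set" where
  "CM_pairs n = {(X, Y). X \<in> carrier_mat n n \<and> Y \<in> carrier_mat n n \<and>
      vec_space.rank n (X * Y - Y * X - 1\<^sub>m n) \<le> 1}"

definition conj_pair :: "nat \<Rightarrow> complex mat \<times> complex mat \<Rightarrow> complex mat \<times> complex mat \<Rightarrow> bool" where
  "conj_pair n A B = (\<exists>P Q. P \<in> carrier_mat n n \<and> Q \<in> carrier_mat n n \<and>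
      P * Q = 1\<^sub>m n \<and> Q * P = 1\<^sub>m n \<and>
      fst B = P * fst A * Q \<and> snd B = P * snd A * Q)"

definition Phi :: "nat \<Rightarrow> complex poly \<Rightarrow> complex mat \<times> complex mat \<Rightarrow> complex mat \<times> complex mat" where
  "Phi n p XY = (fst XY + mat_poly_eval n (pderiv p) (snd XY), snd XY)"

definition Psi :: "nat \<Rightarrow> complex poly \<Rightarrow> complex mat \<times> complex mat \<Rightarrow> complex mat \<times> complex mat" where
  "Psi n q XY = (fst XY, snd XY - mat_poly_eval n (pderiv q) (fst XY))"

text \<open>One generator step. Since Phi_p^{-1} = Phi_{-p} and Psi_q^{-1} = Psi_{-q}, the group
  generated by these maps equals the monoid they generate, i.e. finite compositions of steps.\<close>
definition gen_step :: "nat \<Rightarrow> complex mat \<times> complex mat \<Rightarrow> complex mat \<times> complex mat \<Rightarrow> bool" where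
  "gen_step n A B = (\<exists>p. B = Phi n p A \<or> B = Psi n p A)"

end

theory Submission
  imports Defs "HOL-Computational_Algebra.Fundamental_Theorem_Algebra"
    "HOL-Computational_Algebra.Formal_Power_Series"
begin

text \<open>Write \<open>[X, Y] = I + v w\<^sup>T\<close>; the generators change neither \<open>v\<close> nor \<open>w\<close>. Every pair is moved,
  up to conjugation, to one explicit pair.

  First, some \<open>X + p(Y)\<close> has \<open>v\<close> as a cyclic vector. Suppose \<open>f\<close> of degree \<open>k < n\<close> is least with
  \<open>f(X) v = 0\<close>, let \<open>\<phi>\<close> be a left eigenvector of \<open>X\<close> with eigenvalue \<open>\<mu>\<close> that kills all
  \<open>X\<^sup>i v\<close>, and let \<open>u = g(X) v\<close> with \<open>g = (f - f(\<mu>)) / (x - \<mu>)\<close>. If no \<open>X + t Y\<^sup>j\<close> increases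
  the dimension of the Krylov space of \<open>v\<close>, then to first order in \<open>t\<close> all \<open>\<phi> Y\<^sup>j u\<close> vanish.
  Evaluating \<open>\<phi> [X, Y\<^sup>j] u\<close> in two ways then gives, for the generating functions \<open>\<alpha>\<close>, \<open>\<beta>\<close> of
  \<open>\<phi> Y\<^sup>i v\<close> and \<open>w Y\<^sup>i u\<close>, the equation \<open>f(\<mu>) \<alpha> = z \<alpha> \<beta>\<close>. So \<open>\<alpha> = 0\<close>, or
  \<open>f(\<mu>) = 0\<close> and \<open>\<beta> = 0\<close>; both contradict the irreducibility of the pair.

  Next, a map \<open>\<Psi>\<close> achieves \<open>Y v = 0\<close>. In the basis \<open>X\<^sup>i v\<close> the matrix \<open>Y\<close> is then strictly
  triangular with superdiagonal \<open>n - 1, \<dots>, 1\<close>, hence nilpotent with \<open>w\<close> as a cyclic row vector. Finally a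
  map \<open>\<Phi>\<close> achieves \<open>w X = 0\<close>, and in the basis \<open>w Y\<^sup>i\<close> both matrices are determined by \<open>n\<close>.\<close>

subsection \<open>Polynomials acting on vectors\<close>

lemma index_mat_poly_eval:
  assumes A: "A \<in> carrier_mat n n"
  shows "mat_poly_eval n p A \<in> carrier_mat n n"
    and "i < n \<Longrightarrow> j < n \<Longrightarrow>
      mat_poly_eval n p A $$ (i, j) = (\<Sum>k\<le>degree p. coeff p k * (A ^\<^sub>m k) $$ (i, j))"
proof -
  let ?F = "\<lambda>ks. foldr (\<lambda>i M. coeff p i \<cdot>\<^sub>m (A ^\<^sub>m i) + M) ks (0\<^sub>m n n)"
  have *: "?F ks \<in> carrier_mat n n \<and>
      (\<forall>i<n. \<forall>j<n. ?F ks $$ (i, j) = (\<Sum>k\<leftarrow>ks. coeff p k * (A ^\<^sub>m k) $$ (i, j)))" for ks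
    using A by (induction ks) auto
  show "mat_poly_eval n p A \<in> carrier_mat n n"
    using * unfolding mat_poly_eval_def by blast
  show "mat_poly_eval n p A $$ (i, j) = (\<Sum>k\<le>degree p. coeff p k * (A ^\<^sub>m k) $$ (i, j))"
    if "i < n" "j < n"
    using *[of "[0..<Suc (degree p)]"] that unfolding mat_poly_eval_def
    by (simp del: upt_Suc add: interv_sum_list_conv_sum_set_nat atLeast0LessThan lessThan_Suc_atMost)
qed

lemmas mat_poly_eval_carrier [simp] = index_mat_poly_eval(1)

lemma pow_mat_Suc_left:
  assumes "(A :: complex mat) \<in> carrier_mat n n"
  shows "A ^\<^sub>m Suc k = A * A ^\<^sub>m k"
proof (induction k)
  case (Suc k)
  then show ?case
    using assms by (metis assoc_mult_mat pow_carrier_mat pow_mat.simps(2))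
qed (use assms in auto)

lemma mat_poly_eval_0:
  assumes "A \<in> carrier_mat n n"
  shows "mat_poly_eval n 0 A = 0\<^sub>m n n"
  using index_mat_poly_eval(2)[OF assms, of _ _ 0] carrier_matD[OF index_mat_poly_eval(1)[OF assms, of 0]]
  by (intro eq_matI) auto

lemma mat_poly_eval_pCons:
  assumes A: "A \<in> carrier_mat n n"
  shows "mat_poly_eval n (pCons a p) A = a \<cdot>\<^sub>m 1\<^sub>m n + A * mat_poly_eval n p A"
proof (rule eq_matI, goal_cases)
  case (1 i j)
  then have ij: "i < n" "j < n"
    using carrier_matD[OF A] carrier_matD[OF index_mat_poly_eval(1)[OF A, of p]] by auto
  have d: "degree (pCons a p) \<le> Suc (degree p)"
    by (rule degree_pCons_le)
  have "mat_poly_eval n (pCons a p) A $$ (i, j)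
      = (\<Sum>k\<le>Suc (degree p). coeff (pCons a p) k * (A ^\<^sub>m k) $$ (i, j))"
    unfolding index_mat_poly_eval(2)[OF A ij] using d
    by (intro sum.mono_neutral_left) (auto simp: coeff_eq_0)
  also have "\<dots> = a * 1\<^sub>m n $$ (i, j) + (\<Sum>k\<le>degree p. coeff p k * (A * A ^\<^sub>m k) $$ (i, j))"
    using A by (subst sum.atMost_Suc_shift) (simp add: pow_mat_Suc_left[OF A] del: pow_mat.simps(2))
  also have "(\<Sum>k\<le>degree p. coeff p k * (A * A ^\<^sub>m k) $$ (i, j))
      = (\<Sum>k\<le>degree p. \<Sum>l<n. A $$ (i, l) * (coeff p k * (A ^\<^sub>m k) $$ (l, j)))"
    using A ij by (intro sum.cong refl)
      (simp add: scalar_prod_def atLeast0LessThan sum_distrib_left mult_ac)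
  also have "\<dots> = (\<Sum>l<n. A $$ (i, l) * mat_poly_eval n p A $$ (l, j))"
    by (subst sum.swap) (simp add: index_mat_poly_eval(2)[OF A] ij sum_distrib_left)
  also have "\<dots> = (A * mat_poly_eval n p A) $$ (i, j)"
    using carrier_matD[OF A] ij carrier_matD[OF index_mat_poly_eval(1)[OF A, of p]]
    by (simp add: scalar_prod_def atLeast0LessThan)
  finally show ?case
    using carrier_matD[OF A] ij carrier_matD[OF index_mat_poly_eval(1)[OF A, of p]] by simp
qed (use carrier_matD[OF A] carrier_matD[OF index_mat_poly_eval(1)[OF A]] in auto)

text \<open>The matrix size is read off the vector, so \<open>p(A) x\<close> carries no dimension
  argument.\<close>

definition poly_act :: "complex poly \<Rightarrow> complex mat \<Rightarrow> complex vec \<Rightarrow> complex vec" where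
  "poly_act p A x = mat_poly_eval (dim_vec x) p A *\<^sub>v x"

context
  fixes n :: nat and A :: "complex mat" and x :: "complex vec"
  assumes A [simp]: "A \<in> carrier_mat n n" and x [simp]: "x \<in> carrier_vec n"
begin

lemma dims [simp]: "dim_row A = n" "dim_col A = n" "dim_vec x = n"
  using carrier_matD[OF A] carrier_vecD[OF x] by auto

lemma poly_act_carrier [simp]: "poly_act p A x \<in> carrier_vec n"
  unfolding poly_act_def by (simp add: mult_mat_vec_carrier[of _ n n])

lemma dim_poly_act [simp]: "dim_vec (poly_act p A x) = n"
  using poly_act_carrier by (rule carrier_vecD)

lemma poly_act_0: "poly_act 0 A x = 0\<^sub>v n"
  unfolding poly_act_def dims mat_poly_eval_0[OF A] by (rule eq_vecI) auto

lemma poly_act_pCons: "poly_act (pCons a p) A x = a \<cdot>\<^sub>v x + A *\<^sub>v poly_act p A x"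
proof -
  have "poly_act (pCons a p) A x = (a \<cdot>\<^sub>m 1\<^sub>m n) *\<^sub>v x + (A * mat_poly_eval n p A) *\<^sub>v x"
    unfolding poly_act_def dims mat_poly_eval_pCons[OF A]
    by (rule add_mult_distrib_mat_vec[of _ n n]) (auto intro!: mult_carrier_mat[of _ n n])
  also have "(a \<cdot>\<^sub>m 1\<^sub>m n) *\<^sub>v x = a \<cdot>\<^sub>v x"
    by (intro eq_vecI) auto
  also have "(A * mat_poly_eval n p A) *\<^sub>v x = A *\<^sub>v poly_act p A x"
    unfolding poly_act_def dims by (rule assoc_mult_mat_vec[of _ n n _ n]) auto
  finally show ?thesis .
qed

lemma poly_act_add: "poly_act (p + q) A x = poly_act p A x + poly_act q A x"
proof (induction p q rule: poly_induct2)
  case (pCons a p b q)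
  have "A *\<^sub>v (poly_act p A x + poly_act q A x) = A *\<^sub>v poly_act p A x + A *\<^sub>v poly_act q A x"
    by (rule mult_add_distrib_mat_vec[of _ n n]) auto
  then show ?case
    unfolding add_pCons poly_act_pCons pCons.IH by (intro eq_vecI) (auto simp del: A x simp: algebra_simps)
qed (auto simp: poly_act_0)

lemma poly_act_smult: "poly_act (smult c p) A x = c \<cdot>\<^sub>v poly_act p A x"
proof (induction p)
  case (pCons a p)
  have "A *\<^sub>v (c \<cdot>\<^sub>v poly_act p A x) = c \<cdot>\<^sub>v (A *\<^sub>v poly_act p A x)"
    by (rule mult_mat_vec[of _ n n]) auto
  then show ?case
    unfolding smult_pCons poly_act_pCons pCons.IH by (intro eq_vecI) (auto simp del: A x simp: algebra_simps)
qed (auto simp: poly_act_0)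

lemma poly_act_uminus: "poly_act (- p) A x = - poly_act p A x"
  using poly_act_smult[of "-1" p] by (auto intro!: eq_vecI)

lemma poly_act_diff: "poly_act (p - q) A x = poly_act p A x - poly_act q A x"
  using poly_act_add[of p "- q"] by (auto simp: poly_act_uminus intro!: eq_vecI)

lemma poly_act_const: "poly_act [:c:] A x = c \<cdot>\<^sub>v x"
  unfolding poly_act_pCons poly_act_0 by (intro eq_vecI) auto

lemma poly_act_1: "poly_act 1 A x = x"
  using poly_act_const[of 1] by (simp add: pCons_one)

lemma pow_mat_Suc_vec: "A ^\<^sub>m Suc k *\<^sub>v x = A *\<^sub>v (A ^\<^sub>m k *\<^sub>v x)"
  unfolding pow_mat_Suc_left[OF A] by (rule assoc_mult_mat_vec[of A n n _ n]) auto

lemma pow_mat_Suc_vec': "A ^\<^sub>m Suc k *\<^sub>v x = A ^\<^sub>m k *\<^sub>v (A *\<^sub>v x)"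
  unfolding pow_mat.simps by (rule assoc_mult_mat_vec[of _ n n _ n]) auto

lemma pow_mat_0_vec: "A ^\<^sub>m 0 *\<^sub>v x = x"
  using carrier_matD[OF A] x by simp

lemma pow_mat_vec_carrier [simp]: "A ^\<^sub>m k *\<^sub>v x \<in> carrier_vec n"
  by (rule mult_mat_vec_carrier[of _ n n]) auto

end

lemma scalar_prod_mat_vec:
  fixes A :: "complex mat"
  assumes "A \<in> carrier_mat n n" "x \<in> carrier_vec n" "y \<in> carrier_vec n"
  shows "y \<bullet> (A *\<^sub>v x) = (A\<^sup>T *\<^sub>v y) \<bullet> x"
  using transpose_vec_mult_scalar[OF assms] by (rule sym)

text \<open>The induction moves one factor \<open>A\<close> at a time onto \<open>y\<close> as
  \<open>A\<^sup>T\<close>, hence the generalized \<open>y\<close>. Any bound \<open>N\<close> on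
  the coefficients is allowed, so that sums for different polynomials can share one range.\<close>

lemma scalar_prod_poly_act:
  assumes A: "A \<in> carrier_mat n n" and x: "x \<in> carrier_vec n" and y: "y \<in> carrier_vec n"
    and N: "\<forall>k\<ge>N. coeff p k = 0"
  shows "y \<bullet> poly_act p A x = (\<Sum>k<N. coeff p k * (y \<bullet> (A ^\<^sub>m k *\<^sub>v x)))"
  using y N
proof (induction p arbitrary: y N)
  case 0
  then show ?case
    using A x by (simp add: poly_act_0)
next
  case (pCons a p)
  show ?case
  proof (cases N)
    case 0
    then have "pCons a p = 0"
      using pCons.prems(2) by (metis le0 leading_coeff_0_iff)
    then show ?thesis
      using pCons.hyps by simp
  next
    case (Suc M)
    have y': "A\<^sup>T *\<^sub>v y \<in> carrier_vec n"
      using A pCons.prems by simp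
    have M: "\<forall>k\<ge>M. coeff p k = 0"
      using pCons.prems(2) unfolding Suc by (metis Suc_le_mono coeff_pCons_Suc)
    have "y \<bullet> poly_act (pCons a p) A x = a * (y \<bullet> x) + y \<bullet> (A *\<^sub>v poly_act p A x)"
      unfolding poly_act_pCons[OF A x] using A x pCons.prems
      by (simp add: scalar_prod_add_distrib[of _ n])
    also have "y \<bullet> (A *\<^sub>v poly_act p A x) = (A\<^sup>T *\<^sub>v y) \<bullet> poly_act p A x"
      using A x pCons.prems by (intro scalar_prod_mat_vec[of A n]) auto
    also have "\<dots> = (\<Sum>k<M. coeff p k * (y \<bullet> (A ^\<^sub>m Suc k *\<^sub>v x)))"
      unfolding pCons.IH[OF y' M] pow_mat_Suc_vec[OF A x]
      using A x pCons.prems by (intro sum.cong refl) (simp add: scalar_prod_mat_vec[of A n])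
    finally show ?thesis
      unfolding Suc sum.lessThan_Suc_shift using A x pow_mat_0_vec[OF A x] by simp
  qed
qed

lemma poly_act_mult:
  assumes A: "A \<in> carrier_mat n n" and x: "x \<in> carrier_vec n"
  shows "poly_act (p * q) A x = poly_act p A (poly_act q A x)"
proof (induction p)
  case (pCons a p)
  show ?case
    unfolding mult_pCons_left poly_act_add[OF A x] poly_act_smult[OF A x] poly_act_pCons[OF A x]
      poly_act_pCons[OF A poly_act_carrier[OF A x]] pCons.IH
    using A x by (intro eq_vecI) auto
qed (use A x in \<open>simp add: poly_act_0\<close>)

lemma poly_act_monom:
  assumes A: "A \<in> carrier_mat n n" and x: "x \<in> carrier_vec n"
  shows "poly_act (monom c k) A x = c \<cdot>\<^sub>v (A ^\<^sub>m k *\<^sub>v x)"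
proof (induction k)
  case (Suc k)
  have "A *\<^sub>v (c \<cdot>\<^sub>v (A ^\<^sub>m k *\<^sub>v x)) = c \<cdot>\<^sub>v (A *\<^sub>v (A ^\<^sub>m k *\<^sub>v x))"
    using A x by (intro mult_mat_vec[of _ n n]) auto
  then show ?case
    unfolding monom_Suc poly_act_pCons[OF A x] Suc pow_mat_Suc_vec[OF A x]
    using carrier_matD[OF A] x by (intro eq_vecI) auto
qed (simp only: monom_0 poly_act_const[OF A x] pow_mat_0_vec[OF A x])

lemma mat_poly_eval_vec:
  assumes "x \<in> carrier_vec n"
  shows "mat_poly_eval n p A *\<^sub>v x = poly_act p A x"
  using assms by (simp add: poly_act_def)

lemma poly_act_mat_vec:
  assumes A: "A \<in> carrier_mat n n" and x: "x \<in> carrier_vec n"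
  shows "poly_act p A (A *\<^sub>v x) = A *\<^sub>v poly_act p A x"
proof -
  \<comment> \<open>\<open>A\<close> itself is the action of the polynomial \<open>[:0, 1:]\<close>,
    so commutativity of polynomial multiplication gives the claim.\<close>
  have *: "poly_act [:0, 1:] A y = A *\<^sub>v y" if "y \<in> carrier_vec n" for y
    using A that unfolding poly_act_pCons[OF A that, of 0] poly_act_const[OF A that]
    by (intro eq_vecI) auto
  show ?thesis
    using poly_act_mult[OF A x, of p "[:0, 1:]"] poly_act_mult[OF A x, of "[:0, 1:]" p] A x
    by (simp add: * mult.commute)
qed

subsection \<open>Kernels of matrices\<close>

lemma vec_eq_if_scalar_prod_eq:
  fixes a b :: "complex vec"
  assumes "a \<in> carrier_vec n" "b \<in> carrier_vec n"
    and "\<And>z. z \<in> carrier_vec n \<Longrightarrow> z \<bullet> a = z \<bullet> b"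
  shows "a = b"
proof (rule eq_vecI)
  fix i assume "i < dim_vec b"
  then show "a $ i = b $ i"
    using assms(1,2) assms(3)[of "unit_vec n i"] by simp
qed (use assms in auto)

lemma wide_matrix_kernel:
  fixes M :: "complex mat"
  assumes M: "M \<in> carrier_mat r c" and "r < c"
  shows "\<exists>x \<in> carrier_vec c. x \<noteq> 0\<^sub>v c \<and> M *\<^sub>v x = 0\<^sub>v r"
proof -
  \<comment> \<open>Zero rows make \<open>M\<close> square. The last unit vector then lies in the
    left kernel, which forces \<open>det S = 0\<close>.\<close>
  define S where "S = mat c c (\<lambda>(i, j). if i < r then M $$ (i, j) else 0)"
  have S: "S \<in> carrier_mat c c"
    by (simp add: S_def)
  have "S\<^sup>T *\<^sub>v unit_vec c (c - 1) = 0\<^sub>v c"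
    using \<open>r < c\<close> by (intro eq_vecI) (auto simp: S_def)
  moreover have "unit_vec c (c - 1) \<noteq> (0\<^sub>v c :: complex vec)"
  proof
    assume "unit_vec c (c - 1) = (0\<^sub>v c :: complex vec)"
    then have "unit_vec c (c - 1) $ (c - 1) = (0\<^sub>v c :: complex vec) $ (c - 1)"
      by simp
    then show False
      using \<open>r < c\<close> by simp
  qed
  ultimately have "det (S\<^sup>T) = 0"
    unfolding det_0_iff_vec_prod_zero[OF transpose_carrier_mat[THEN iffD2, OF S]]
    using unit_vec_carrier by blast
  then obtain x where x: "x \<in> carrier_vec c" "x \<noteq> 0\<^sub>v c" "S *\<^sub>v x = 0\<^sub>v c"
    using S unfolding det_transpose[OF S] det_0_iff_vec_prod_zero[OF S] by blast
  have "M *\<^sub>v x = 0\<^sub>v r"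
  proof (rule eq_vecI)
    fix i assume "i < dim_vec (0\<^sub>v r :: complex vec)"
    then have i: "i < r"
      by simp
    then have "row M i = row S i"
      using M \<open>r < c\<close> by (intro eq_vecI) (auto simp: S_def)
    moreover have "row S i \<bullet> x = 0"
      using arg_cong[OF x(3), of "\<lambda>u. u $ i"] i \<open>r < c\<close> S by simp
    ultimately show "(M *\<^sub>v x) $ i = 0\<^sub>v r $ i"
      using i M by simp
  qed (use M in auto)
  with x show ?thesis
    by blast
qed

lemma inverse_if_trivial_kernel:
  fixes M :: "complex mat"
  assumes M: "M \<in> carrier_mat n n"
    and inj: "\<And>c. c \<in> carrier_vec n \<Longrightarrow> M *\<^sub>v c = 0\<^sub>v n \<Longrightarrow> c = 0\<^sub>v n"
  shows "\<exists>B \<in> carrier_mat n n. M * B = 1\<^sub>m n \<and> B * M = 1\<^sub>m n"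
proof -
  have "det M \<noteq> 0"
    unfolding det_0_iff_vec_prod_zero[OF M] using inj by blast
  from det_non_zero_imp_unit[OF M this] show ?thesis
    by (auto simp: Units_def ring_mat_def)
qed

text \<open>The Gram matrix of \<open>M t\<close> against \<open>M 0\<close> has a determinant that is continuous in \<open>t\<close>
  and nonzero at \<open>0\<close>.\<close>

lemma trivial_kernel_perturb:
  fixes M :: "complex \<Rightarrow> complex mat"
  assumes M: "\<And>t. M t \<in> carrier_mat n k"
    and cont: "\<And>i j. i < n \<Longrightarrow> j < k \<Longrightarrow> isCont (\<lambda>t. M t $$ (i, j)) 0"
    and inj: "\<And>c. c \<in> carrier_vec k \<Longrightarrow> M 0 *\<^sub>v c = 0\<^sub>v n \<Longrightarrow> c = 0\<^sub>v k"
  shows "\<exists>t. t \<noteq> 0 \<and> (\<forall>c\<in>carrier_vec k. M t *\<^sub>v c = 0\<^sub>v n \<longrightarrow> c = 0\<^sub>v k)"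
proof -
  \<comment> \<open>\<open>H\<close> is the conjugate transpose of \<open>M 0\<close>.\<close>
  define H where "H = (map_mat cnj (M 0))\<^sup>T"
  have H: "H \<in> carrier_mat k n"
    using M[of 0] by (simp add: H_def)
  have G: "H * M t \<in> carrier_mat k k" for t
    using H M by (rule mult_carrier_mat)
  have "c = 0\<^sub>v k" if c: "c \<in> carrier_vec k" and 0: "(H * M 0) *\<^sub>v c = 0\<^sub>v k" for c
  proof -
    let ?y = "M 0 *\<^sub>v c"
    have y: "?y \<in> carrier_vec n"
      using M c by (rule mult_mat_vec_carrier)
    have Hy: "H *\<^sub>v ?y = 0\<^sub>v k"
      using 0 assoc_mult_mat_vec[OF H M c] by simp
    have "conjugate ?y = map_mat cnj (M 0) *\<^sub>v conjugate c"
      using M[of 0] c by (intro eq_vecI) (auto simp: scalar_prod_def)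
    \<comment> \<open>If \<open>H\<close> kills \<open>M 0 *\<^sub>v c\<close>, then the Hermitian
      norm of that vector vanishes.\<close>
    then have "?y \<bullet>c ?y = ?y \<bullet> (map_mat cnj (M 0) *\<^sub>v conjugate c)"
      by simp
    also have "\<dots> = (H *\<^sub>v ?y) \<bullet> conjugate c"
      unfolding H_def using M[of 0] c y
      by (intro transpose_vec_mult_scalar[symmetric, of _ n k]) auto
    also have "\<dots> = 0"
      using Hy c by simp
    finally have "?y = 0\<^sub>v n"
      using conjugate_square_eq_0_vec[OF y] by simp
    then show ?thesis
      using inj c by blast
  qed
  then have det0: "det (H * M 0) \<noteq> 0"
    unfolding det_0_iff_vec_prod_zero[OF G] by blast
  have cG: "isCont (\<lambda>t. (H * M t) $$ (i, j)) 0" if "i < k" "j < k" for i j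
  proof -
    have "(H * M t) $$ (i, j) = (\<Sum>l = 0..<n. H $$ (i, l) * M t $$ (l, j))" for t
      using that H M[of t] by (simp add: scalar_prod_def)
    then show ?thesis
      using cont that by (auto intro!: continuous_intros)
  qed
  \<comment> \<open>By the Leibniz formula the determinant is a polynomial in the entries.\<close>
  have "isCont (\<lambda>t. det (H * M t)) 0"
    unfolding det_def'[OF G]
    by (intro continuous_intros cG) (auto dest: permutes_in_image)
  then have "((\<lambda>t. det (H * M t)) \<longlongrightarrow> det (H * M 0)) (at 0)"
    by (simp add: isCont_def)
  from tendsto_imp_eventually_ne[OF this det0]
  have "\<forall>\<^sub>F t in at 0. det (H * M t) \<noteq> 0 \<and> t \<noteq> 0"
    using eventually_neq_at_within by (rule eventually_conj)
  then obtain t where t: "det (H * M t) \<noteq> 0" "t \<noteq> 0"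
    using eventually_happens' by (metis (mono_tags, lifting) at_neq_bot)
  have "c = 0\<^sub>v k" if c: "c \<in> carrier_vec k" and 0: "M t *\<^sub>v c = 0\<^sub>v n" for c
  proof -
    have "(H * M t) *\<^sub>v c = 0\<^sub>v k"
      unfolding assoc_mult_mat_vec[OF H M c] 0 using H by (intro eq_vecI) auto
    then show ?thesis
      using t(1) c unfolding det_0_iff_vec_prod_zero[OF G] by blast
  qed
  with t(2) show ?thesis
    by blast
qed

subsection \<open>Krylov spaces\<close>

definition krylov_mat :: "nat \<Rightarrow> nat \<Rightarrow> complex mat \<Rightarrow> complex vec \<Rightarrow> complex mat" where
  "krylov_mat n k A x = mat n k (\<lambda>(i, j). (A ^\<^sub>m j *\<^sub>v x) $ i)"

text \<open>Linear independence of the first \<open>k\<close> vectors \<open>x\<close>,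
  \<open>A x\<close>, \<open>A^2 x\<close>, ... phrased through polynomials. Vanishing coefficients
  replace a bound on \<open>degree\<close>, so that \<open>k = 0\<close> admits only the zero
  polynomial.\<close>

definition krylov_indep :: "nat \<Rightarrow> complex mat \<Rightarrow> complex vec \<Rightarrow> bool" where
  "krylov_indep k A x \<longleftrightarrow>
    (\<forall>p. (\<forall>i\<ge>k. coeff p i = 0) \<longrightarrow> poly_act p A x = 0\<^sub>v (dim_vec x) \<longrightarrow> p = 0)"

lemma krylov_mat_carrier [simp]: "krylov_mat n k A x \<in> carrier_mat n k"
  by (simp add: krylov_mat_def)

lemma poly_act_index:
  assumes A: "A \<in> carrier_mat n n" and x: "x \<in> carrier_vec n" and p: "\<forall>i\<ge>k. coeff p i = 0"
    and i: "i < n"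
  shows "poly_act p A x $ i = (\<Sum>j<k. coeff p j * (A ^\<^sub>m j *\<^sub>v x) $ i)"
proof -
  have "poly_act p A x $ i = unit_vec n i \<bullet> poly_act p A x"
    using i poly_act_carrier[OF A x] by simp
  also have "\<dots> = (\<Sum>j<k. coeff p j * (unit_vec n i \<bullet> (A ^\<^sub>m j *\<^sub>v x)))"
    using assms by (intro scalar_prod_poly_act[of _ n]) auto
  finally show ?thesis
    using i pow_mat_vec_carrier[OF A x] by simp
qed

lemma krylov_mat_vec:
  assumes A: "A \<in> carrier_mat n n" and x: "x \<in> carrier_vec n" and "\<forall>i\<ge>k. coeff p i = 0"
  shows "krylov_mat n k A x *\<^sub>v vec k (coeff p) = poly_act p A x"
proof (rule eq_vecI)
  fix i assume "i < dim_vec (poly_act p A x)"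
  then have i: "i < n"
    using dim_poly_act[OF A x] by simp
  have "poly_act p A x $ i = (\<Sum>j<k. (A ^\<^sub>m j *\<^sub>v x) $ i * coeff p j)"
    using poly_act_index[OF A x assms(3) i] by (simp add: mult.commute)
  also have "\<dots> = (krylov_mat n k A x *\<^sub>v vec k (coeff p)) $ i"
    using i by (simp add: krylov_mat_def scalar_prod_def atLeast0LessThan)
  finally show "(krylov_mat n k A x *\<^sub>v vec k (coeff p)) $ i = poly_act p A x $ i" ..
qed (use dim_poly_act[OF A x] in \<open>simp add: krylov_mat_def\<close>)

lemma vec_is_vec_coeff:
  assumes "c \<in> carrier_vec k"
  shows "\<exists>p :: complex poly. (\<forall>i\<ge>k. coeff p i = 0) \<and> c = vec k (coeff p)"
proof (intro exI conjI)
  let ?p = "\<Sum>j<k. monom (c $ j) j"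
  have *: "coeff ?p i = (if i < k then c $ i else 0)" for i
    by (simp add: coeff_sum)
  show "\<forall>i\<ge>k. coeff ?p i = 0"
    using * by simp
  show "c = vec k (coeff ?p)"
    using assms by (intro eq_vecI) (auto simp: *)
qed

lemma vec_coeff_eq_0_iff:
  assumes "\<forall>i\<ge>k. coeff p i = 0"
  shows "vec k (coeff p) = 0\<^sub>v k \<longleftrightarrow> p = 0"
proof
  assume *: "vec k (coeff p) = 0\<^sub>v k"
  show "p = 0"
  proof (rule poly_eqI)
    fix i show "coeff p i = coeff 0 i"
      using assms arg_cong[OF *, of "\<lambda>u. u $ i"] by (cases "i < k") auto
  qed
qed (auto intro: eq_vecI)

text \<open>The \<open>n + 1\<close> vectors \<open>x\<close>, \<open>A x\<close>, ...,
  \<open>A^n x\<close> are linearly dependent.\<close>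

lemma ex_annihilating_poly:
  assumes A: "A \<in> carrier_mat n n" and x: "x \<in> carrier_vec n"
  shows "\<exists>p. p \<noteq> 0 \<and> poly_act p A x = 0\<^sub>v n"
proof -
  obtain c where c: "c \<in> carrier_vec (Suc n)" "c \<noteq> 0\<^sub>v (Suc n)"
      "krylov_mat n (Suc n) A x *\<^sub>v c = 0\<^sub>v n"
    using wide_matrix_kernel[OF krylov_mat_carrier, of n "Suc n"] by blast
  obtain p where p: "\<forall>i\<ge>Suc n. coeff p i = 0" "c = vec (Suc n) (coeff p)"
    using vec_is_vec_coeff[OF c(1)] by blast
  then show ?thesis
    using c(2,3) krylov_mat_vec[OF A x p(1)] vec_coeff_eq_0_iff[OF p(1)] by auto
qed

lemma krylov_mat_inverse:
  assumes A: "A \<in> carrier_mat n n" and x: "x \<in> carrier_vec n" and "krylov_indep n A x"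
  shows "\<exists>B \<in> carrier_mat n n. krylov_mat n n A x * B = 1\<^sub>m n \<and> B * krylov_mat n n A x = 1\<^sub>m n"
proof (rule inverse_if_trivial_kernel)
  fix c :: "complex vec"
  assume c: "c \<in> carrier_vec n" and 0: "krylov_mat n n A x *\<^sub>v c = 0\<^sub>v n"
  obtain p where p: "\<forall>i\<ge>n. coeff p i = 0" "c = vec n (coeff p)"
    using vec_is_vec_coeff[OF c] by blast
  then have "p = 0"
    using 0 krylov_mat_vec[OF A x p(1)] assms(3) x unfolding krylov_indep_def by auto
  then show "c = 0\<^sub>v n"
    using p by (auto intro!: eq_vecI)
qed simp

lemma krylov_indep_spans:
  assumes A: "A \<in> carrier_mat n n" and x: "x \<in> carrier_vec n" and "krylov_indep n A x"
    and y: "y \<in> carrier_vec n"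
  shows "\<exists>p. (\<forall>i\<ge>n. coeff p i = 0) \<and> poly_act p A x = y"
proof -
  obtain B where B: "B \<in> carrier_mat n n" "krylov_mat n n A x * B = 1\<^sub>m n"
    using krylov_mat_inverse[OF assms(1-3)] by blast
  obtain p where p: "\<forall>i\<ge>n. coeff p i = 0" "B *\<^sub>v y = vec n (coeff p)"
    using vec_is_vec_coeff[OF mult_mat_vec_carrier[OF B(1) y]] by blast
  have "y = (krylov_mat n n A x * B) *\<^sub>v y"
    using B(2) y by simp
  also have "\<dots> = poly_act p A x"
    unfolding assoc_mult_mat_vec[OF krylov_mat_carrier B(1) y] p(2)
    by (rule krylov_mat_vec[OF A x p(1)])
  finally show ?thesis
    using p(1) by blast
qed

text \<open>Take an annihilating polynomial of least degree and split off a linear factor: the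
  cofactor does not annihilate \<open>x\<close>, but yields a vector killed by
  \<open>A - \<mu>\<close>. Having the eigenvector in the form \<open>h(A) x\<close> lets it inherit
  properties of the whole Krylov space of \<open>x\<close>.\<close>

lemma poly_act_eigenvector:
  assumes A: "A \<in> carrier_mat n n" and x: "x \<in> carrier_vec n" and "x \<noteq> 0\<^sub>v n"
  shows "\<exists>h \<mu>. poly_act h A x \<noteq> 0\<^sub>v n \<and> A *\<^sub>v poly_act h A x = \<mu> \<cdot>\<^sub>v poly_act h A x"
proof -
  obtain m where m: "m \<noteq> 0" "poly_act m A x = 0\<^sub>v n"
    and least: "\<And>p. p \<noteq> 0 \<Longrightarrow> poly_act p A x = 0\<^sub>v n \<Longrightarrow> degree m \<le> degree p"
    using ex_has_least_nat[of "\<lambda>p. p \<noteq> 0 \<and> poly_act p A x = 0\<^sub>v n" _ degree]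
      ex_annihilating_poly[OF A x] by blast
  \<comment> \<open>A nonzero constant cannot annihilate \<open>x \<noteq> 0\<close>, so
    \<open>m\<close> has a root.\<close>
  have "degree m \<noteq> 0"
  proof
    assume "degree m = 0"
    then obtain c where c: "m = [:c:]"
      by (rule degree_eq_zeroE)
    then have "c \<noteq> 0" "c \<cdot>\<^sub>v x = 0\<^sub>v n"
      using m poly_act_const[OF A x] by auto
    then have "inverse c \<cdot>\<^sub>v (c \<cdot>\<^sub>v x) = 0\<^sub>v n"
      by (intro eq_vecI) auto
    then show False
      using \<open>c \<noteq> 0\<close> \<open>x \<noteq> 0\<^sub>v n\<close> by (simp add: smult_smult_assoc)
  qed
  then obtain \<mu> where "poly m \<mu> = 0"
    using fundamental_theorem_of_algebra[of m] by (auto simp: constant_degree)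
  then obtain h where h: "m = [:- \<mu>, 1:] * h"
    by (auto simp: poly_eq_0_iff_dvd dvd_def)
  let ?y = "poly_act h A x"
  have y: "?y \<in> carrier_vec n"
    by (rule poly_act_carrier[OF A x])
  have "h \<noteq> 0"
    using m(1) h by auto
  then have "degree m = Suc (degree h)"
    unfolding h using degree_mult_eq[of "[:- \<mu>, 1:]" h] by simp
  then have "?y \<noteq> 0\<^sub>v n"
    using least[of h] \<open>h \<noteq> 0\<close> by auto
  moreover have "A *\<^sub>v ?y = \<mu> \<cdot>\<^sub>v ?y"
  proof -
    have *: "- \<mu> \<cdot>\<^sub>v ?y + A *\<^sub>v ?y = 0\<^sub>v n"
      using m(2) poly_act_pCons[OF A y, of "-\<mu>" 1]
      unfolding h poly_act_mult[OF A x] by (simp add: poly_act_1[OF A y] pCons_one)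
    show ?thesis
    proof (rule eq_vecI)
      fix i assume "i < dim_vec (\<mu> \<cdot>\<^sub>v ?y)"
      then show "(A *\<^sub>v ?y) $ i = (\<mu> \<cdot>\<^sub>v ?y) $ i"
        using arg_cong[OF *, of "\<lambda>u. u $ i"] carrier_vecD[OF y] carrier_matD[OF A] by simp
    qed (use carrier_vecD[OF y] carrier_matD[OF A] in simp)
  qed
  ultimately show ?thesis
    by blast
qed

lemma poly_act_transpose:
  assumes A: "A \<in> carrier_mat n n" and x: "x \<in> carrier_vec n" and y: "y \<in> carrier_vec n"
  shows "poly_act p (A\<^sup>T) y \<bullet> x = y \<bullet> poly_act p A x"
proof -
  have AT: "A\<^sup>T \<in> carrier_mat n n"
    using A by simp
  show ?thesis
    using x
  proof (induction p arbitrary: x)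
    case (pCons a p)
    have "poly_act (pCons a p) (A\<^sup>T) y \<bullet> x = a * (y \<bullet> x) + (A\<^sup>T *\<^sub>v poly_act p (A\<^sup>T) y) \<bullet> x"
      unfolding poly_act_pCons[OF AT y]
      using y AT pCons.prems poly_act_carrier[OF AT y]
      by (subst add_scalar_prod_distrib[of _ n]) auto
    also have "(A\<^sup>T *\<^sub>v poly_act p (A\<^sup>T) y) \<bullet> x = poly_act p (A\<^sup>T) y \<bullet> (A *\<^sub>v x)"
      using transpose_vec_mult_scalar[OF A pCons.prems poly_act_carrier[OF AT y]] .
    also have "\<dots> = y \<bullet> (A *\<^sub>v poly_act p A x)"
      using pCons.IH[of "A *\<^sub>v x"] A pCons.prems by (simp add: poly_act_mat_vec)
    also have "a * (y \<bullet> x) + \<dots> = y \<bullet> poly_act (pCons a p) A x"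
      unfolding poly_act_pCons[OF A pCons.prems]
      using y A pCons.prems poly_act_carrier[OF A pCons.prems]
      by (subst scalar_prod_add_distrib[of _ n]) auto
    finally show ?case .
  qed (use y AT A in \<open>simp add: poly_act_0\<close>)
qed

lemma poly_act_zero_vec:
  assumes A: "A \<in> carrier_mat n n"
  shows "poly_act p A (0\<^sub>v n) = 0\<^sub>v n"
  unfolding poly_act_def using carrier_matD[OF mat_poly_eval_carrier[OF A, of p]]
  by (intro eq_vecI) (auto simp: scalar_prod_def)

lemma mat_eq_if_vec_eq:
  fixes A B :: "complex mat"
  assumes "A \<in> carrier_mat n n" "B \<in> carrier_mat n n"
    and "\<And>x. x \<in> carrier_vec n \<Longrightarrow> A *\<^sub>v x = B *\<^sub>v x"
  shows "A = B"
proof (rule eq_matI)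
  fix i j assume "i < dim_row B" "j < dim_col B"
  then show "A $$ (i, j) = B $$ (i, j)"
    using assms(1,2) arg_cong[OF assms(3)[of "unit_vec n j"], of "\<lambda>u. u $ i"] by simp
qed (use assms in auto)

section \<open>Synthetic division and first-order perturbation of Krylov spaces\<close>

lemma coeff_synthetic_div_eq_0:
  assumes "\<forall>i\<ge>N. coeff f i = (0 :: complex)"
  shows "\<forall>i\<ge>N. coeff (synthetic_div f \<mu>) i = 0"
proof (cases "f = 0")
  case False
  then have "degree f < N"
    using assms by (metis leading_coeff_0_iff not_less)
  then show ?thesis
    by (auto intro!: coeff_eq_0 simp: degree_synthetic_div)
qed simp

text \<open>The recursion unfolds to \<alpha>(m) as the sum of \<open>\<mu>^(m-1-i) * s i\<close>
  over \<open>i < m\<close>, while the coefficient \<open>i\<close> of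
  \<open>(f - f(\<mu>)) / (x - \<mu>)\<close> is the sum of \<open>coeff f m * \<mu>^(m-1-i)\<close>
  over \<open>m > i\<close>. Both sides are the same double sum; the induction on \<open>f\<close>
  follows Horner's scheme.\<close>

lemma sum_coeff_synthetic_div:
  fixes f :: "complex poly"
  assumes "\<alpha> 0 = 0" and "\<And>m. \<alpha> (Suc m) = \<mu> * \<alpha> m + s m" and "\<forall>i\<ge>N. coeff f i = 0"
  shows "(\<Sum>m<N. coeff f m * \<alpha> m) = (\<Sum>m<N. coeff (synthetic_div f \<mu>) m * s m)"
  using assms(3)
proof (induction f arbitrary: N)
  case (pCons a f)
  show ?case
  proof (cases N)
    case (Suc M)
    have M: "\<forall>i\<ge>M. coeff f i = 0"
      using pCons.prems unfolding Suc by (metis Suc_le_mono coeff_pCons_Suc)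
    have *: "coeff (synthetic_div (pCons a f) \<mu>) m = coeff f m + \<mu> * coeff (synthetic_div f \<mu>) m" for m
      using arg_cong[OF synthetic_div_correct[of f \<mu>], of "\<lambda>p. coeff p m"] by simp
    have "(\<Sum>m<N. coeff (pCons a f) m * \<alpha> m) = (\<Sum>m<M. coeff f m * (\<mu> * \<alpha> m + s m))"
      unfolding Suc sum.lessThan_Suc_shift by (simp add: assms(1,2))
    also have "\<dots> = \<mu> * (\<Sum>m<M. coeff f m * \<alpha> m) + (\<Sum>m<M. coeff f m * s m)"
      by (simp add: algebra_simps sum.distrib sum_distrib_left)
    also have "\<dots> = (\<Sum>m<M. coeff (synthetic_div (pCons a f) \<mu>) m * s m)"
      unfolding pCons.IH[OF M] * by (simp add: algebra_simps sum.distrib sum_distrib_left)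
    also have "\<dots> = (\<Sum>m<N. coeff (synthetic_div (pCons a f) \<mu>) m * s m)"
      unfolding Suc using M coeff_synthetic_div_eq_0[OF M, of \<mu>]
      by (simp add: * del: synthetic_div_pCons)
    finally show ?thesis .
  qed simp
qed simp

text \<open>First-order perturbation: \<open>X + tP\<close> moves \<open>f(X) v = 0\<close> by \<open>t b(t)\<close>, where
  \<open>\<phi> \<bullet> b(0) = \<phi> \<bullet> P g(X) v\<close> with \<open>g = (f - f(\<mu>)) / (x - \<mu>)\<close>.\<close>

lemma krylov_indep_perturb:
  fixes X P :: "complex mat" and v \<phi> :: "complex vec"
  assumes X: "X \<in> carrier_mat n n" and P: "P \<in> carrier_mat n n" and v: "v \<in> carrier_vec n"
    and indep: "krylov_indep k X v"
    and f: "\<forall>i\<ge>Suc k. coeff f i = 0" "coeff f k \<noteq> 0" "poly_act f X v = 0\<^sub>v n"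
    and phi: "\<phi> \<in> carrier_vec n" "X\<^sup>T *\<^sub>v \<phi> = \<mu> \<cdot>\<^sub>v \<phi>"
    and kill: "\<And>p. \<phi> \<bullet> poly_act p X v = 0"
    and nz: "\<phi> \<bullet> (P *\<^sub>v poly_act (synthetic_div f \<mu>) X v) \<noteq> 0"
  shows "\<exists>t. krylov_indep (Suc k) (X + t \<cdot>\<^sub>m P) v"
proof -
  define Z where "Z t = X + t \<cdot>\<^sub>m P" for t
  \<comment> \<open>\<open>a t m\<close> is the difference quotient of
    \<open>Z t ^\<^sub>m m *\<^sub>v v\<close> at \<open>0\<close>, given by a recursion that still
    makes sense for \<open>t = 0\<close>.\<close>
  define a where "a t = rec_nat (0\<^sub>v n) (\<lambda>m y. X *\<^sub>v y + P *\<^sub>v (Z t ^\<^sub>m m *\<^sub>v v))" for t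
  \<comment> \<open>Since \<open>f(X) v = 0\<close>, this is \<open>f(Z t) v\<close> divided by
    \<open>t\<close>, extended to \<open>t = 0\<close>; see \<open>fb\<close>.\<close>
  define b where "b t = vec n (\<lambda>i. \<Sum>m<Suc k. coeff f m * a t m $ i)" for t
  have Z: "Z t \<in> carrier_mat n n" for t
    using X P by (simp add: Z_def)
  have Zv: "Z t ^\<^sub>m m *\<^sub>v v \<in> carrier_vec n" for t m
    by (rule pow_mat_vec_carrier[OF Z v])
  have Z0: "Z 0 = X"
    unfolding Z_def using X P by (intro eq_matI) auto
  have a0: "a t 0 = 0\<^sub>v n" and aSuc: "a t (Suc m) = X *\<^sub>v a t m + P *\<^sub>v (Z t ^\<^sub>m m *\<^sub>v v)" for t m
    by (simp_all add: a_def)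
  have a: "a t m \<in> carrier_vec n" for t m
  proof (induction m)
    case (Suc m)
    then show ?case
      unfolding aSuc using X P Zv[of t m] by (intro add_carrier_vec) (auto intro: mult_mat_vec_carrier)
  qed (simp add: a0)
  have b: "b t \<in> carrier_vec n" for t
    by (simp add: b_def)
  have expand: "Z t ^\<^sub>m m *\<^sub>v v = X ^\<^sub>m m *\<^sub>v v + t \<cdot>\<^sub>v a t m" for t m
  proof (induction m)
    case 0
    show ?case
      unfolding a0 pow_mat_0_vec[OF X v] pow_mat_0_vec[OF Z v] using v by (intro eq_vecI) auto
  next
    case (Suc m)
    let ?z = "Z t ^\<^sub>m m *\<^sub>v v"
    have "Z t ^\<^sub>m Suc m *\<^sub>v v = X *\<^sub>v ?z + (t \<cdot>\<^sub>m P) *\<^sub>v ?z"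
      unfolding pow_mat_Suc_vec[OF Z v] by (subst Z_def)
        (rule add_mult_distrib_mat_vec[of _ n n], use X P Zv in auto)
    also have "(t \<cdot>\<^sub>m P) *\<^sub>v ?z = t \<cdot>\<^sub>v (P *\<^sub>v ?z)"
      using P carrier_vecD[OF Zv[of t m]] by (intro eq_vecI) (auto simp del: Z_def)
    also have "X *\<^sub>v ?z = X ^\<^sub>m Suc m *\<^sub>v v + t \<cdot>\<^sub>v (X *\<^sub>v a t m)"
      unfolding Suc pow_mat_Suc_vec[OF X v]
      using X a pow_mat_vec_carrier[OF X v, of m]
      by (simp add: mult_add_distrib_mat_vec[of _ n n] mult_mat_vec[of _ n n])
    finally show ?case
      unfolding aSuc using X P carrier_vecD[OF Zv[of t m]] carrier_vecD[OF a[of t m]]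
        carrier_vecD[OF pow_mat_vec_carrier[OF X v, of "Suc m"]]
      by (intro eq_vecI) (auto simp: algebra_simps simp del: pow_mat.simps)
  qed
  have cont_Z: "isCont (\<lambda>t. (Z t ^\<^sub>m m *\<^sub>v v) $ i) 0" if "i < n" for i m
    using that
  proof (induction m arbitrary: i)
    case 0
    then show ?case
      unfolding pow_mat_0_vec[OF Z v] by simp
  next
    case (Suc m)
    have "(Z t ^\<^sub>m Suc m *\<^sub>v v) $ i
        = (\<Sum>l<n. (X $$ (i, l) + t * P $$ (i, l)) * (Z t ^\<^sub>m m *\<^sub>v v) $ l)" for t
      unfolding pow_mat_Suc_vec[OF Z v]
      using Suc.prems X P carrier_matD[OF Z[of t]] carrier_vecD[OF Zv[of t m]]
      by (simp add: scalar_prod_def atLeast0LessThan Z_def)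
    then show ?case
      using Suc.IH by (auto intro!: continuous_intros)
  qed
  have cont_a: "isCont (\<lambda>t. a t m $ i) 0" if "i < n" for i m
    using that
  proof (induction m arbitrary: i)
    case (Suc m)
    have "a t (Suc m) $ i
        = (\<Sum>l<n. X $$ (i, l) * a t m $ l) + (\<Sum>l<n. P $$ (i, l) * (Z t ^\<^sub>m m *\<^sub>v v) $ l)" for t
      unfolding aSuc using Suc.prems X P carrier_vecD[OF a[of t m]] carrier_vecD[OF Zv[of t m]]
      by (simp add: scalar_prod_def atLeast0LessThan)
    then show ?case
      using Suc.IH cont_Z by (auto intro!: continuous_intros)
  qed (simp add: a0)
  have cont_b: "isCont (\<lambda>t. b t $ i) 0" if "i < n" for i
    using that cont_a by (auto simp: b_def intro!: continuous_intros)
  have fb: "poly_act f (Z t) v = t \<cdot>\<^sub>v b t" for t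
  proof (rule eq_vecI)
    fix i assume "i < dim_vec (t \<cdot>\<^sub>v b t)"
    then have i: "i < n"
      by (simp add: b_def)
    have "poly_act f (Z t) v $ i = (\<Sum>m<Suc k. coeff f m * ((X ^\<^sub>m m *\<^sub>v v) $ i + t * a t m $ i))"
      unfolding poly_act_index[OF Z v f(1) i]
    proof (intro sum.cong refl)
      fix m
      show "coeff f m * (Z t ^\<^sub>m m *\<^sub>v v) $ i = coeff f m * ((X ^\<^sub>m m *\<^sub>v v) $ i + t * a t m $ i)"
        unfolding expand using i carrier_vecD[OF a[of t m]] by simp
    qed
    also have "\<dots> = poly_act f X v $ i + t * b t $ i"
      unfolding poly_act_index[OF X v f(1) i] using i
      by (simp add: b_def algebra_simps sum.distrib sum_distrib_left del: sum.lessThan_Suc)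
    finally show "poly_act f (Z t) v $ i = (t \<cdot>\<^sub>v b t) $ i"
      using i f(3) carrier_vecD[OF b[of t]] by simp
  qed (use dim_poly_act[OF Z v] in \<open>simp add: b_def\<close>)
  have "\<phi> \<bullet> b 0 = (\<Sum>m<Suc k. coeff f m * (\<phi> \<bullet> a 0 m))"
  proof -
    have "\<phi> \<bullet> b 0 = (\<Sum>i<n. \<Sum>m<Suc k. coeff f m * (\<phi> $ i * a 0 m $ i))"
      by (simp add: b_def scalar_prod_def atLeast0LessThan sum_distrib_left mult_ac del: sum.lessThan_Suc)
    also have "\<dots> = (\<Sum>m<Suc k. coeff f m * (\<phi> \<bullet> a 0 m))"
      by (subst sum.swap) (simp add: carrier_vecD[OF a] scalar_prod_def atLeast0LessThan
          sum_distrib_left del: sum.lessThan_Suc)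
    finally show ?thesis .
  qed
  \<comment> \<open>Because \<open>\<phi>\<close> is a left eigenvector, pairing it with the
    recursion for \<open>a 0\<close> gives a scalar recursion with multiplier
    \<open>\<mu>\<close>.\<close>
  also have "\<dots> = (\<Sum>m<Suc k. coeff (synthetic_div f \<mu>) m * (\<phi> \<bullet> (P *\<^sub>v (X ^\<^sub>m m *\<^sub>v v))))"
  proof (rule sum_coeff_synthetic_div)
    fix m
    have "\<phi> \<bullet> (X *\<^sub>v a 0 m) = \<mu> * (\<phi> \<bullet> a 0 m)"
      using scalar_prod_mat_vec[OF X a phi(1)] phi a by simp
    then show "\<phi> \<bullet> a 0 (Suc m) = \<mu> * (\<phi> \<bullet> a 0 m) + \<phi> \<bullet> (P *\<^sub>v (X ^\<^sub>m m *\<^sub>v v))"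
      unfolding aSuc Z0 using X P phi a pow_mat_vec_carrier[OF X v, of m]
      by (subst scalar_prod_add_distrib[of _ n]) (auto intro!: mult_mat_vec_carrier[of _ n n])
  qed (use f phi in \<open>auto simp: a0\<close>)
  also have "\<dots> = (\<Sum>m<Suc k. coeff (synthetic_div f \<mu>) m * ((P\<^sup>T *\<^sub>v \<phi>) \<bullet> (X ^\<^sub>m m *\<^sub>v v)))"
    using scalar_prod_mat_vec[OF P pow_mat_vec_carrier[OF X v] phi(1)] by simp
  also have "\<dots> = (P\<^sup>T *\<^sub>v \<phi>) \<bullet> poly_act (synthetic_div f \<mu>) X v"
    by (rule scalar_prod_poly_act[OF X v, symmetric])
      (use P phi coeff_synthetic_div_eq_0[OF f(1)] in \<open>auto intro!: mult_mat_vec_carrier[of _ n n]\<close>)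
  also have "\<dots> = \<phi> \<bullet> (P *\<^sub>v poly_act (synthetic_div f \<mu>) X v)"
    using scalar_prod_mat_vec[OF P poly_act_carrier[OF X v] phi(1)] by simp
  finally have phi_b: "\<phi> \<bullet> b 0 \<noteq> 0"
    using nz by simp
  \<comment> \<open>The last Krylov column \<open>Z t ^\<^sub>m k *\<^sub>v v\<close> is replaced by
    \<open>b t\<close>. The Krylov matrix itself is singular at \<open>t = 0\<close>; with
    \<open>b 0\<close> as last column the kernel becomes trivial.\<close>
  define M where "M t = mat n (Suc k) (\<lambda>(i, j). if j < k then (Z t ^\<^sub>m j *\<^sub>v v) $ i else b t $ i)" for t
  define ext where "ext r s = vec (Suc k) (\<lambda>j. if j < k then coeff r j else s)" for r and s :: complex
  have M_ext: "M t *\<^sub>v ext r s = poly_act r (Z t) v + s \<cdot>\<^sub>v b t" if r: "\<forall>i\<ge>k. coeff r i = 0" for t r s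
  proof (rule eq_vecI)
    fix i assume "i < dim_vec (poly_act r (Z t) v + s \<cdot>\<^sub>v b t)"
    then have i: "i < n"
      by (simp add: b_def)
    have "(M t *\<^sub>v ext r s) $ i = (\<Sum>j<k. (Z t ^\<^sub>m j *\<^sub>v v) $ i * coeff r j) + b t $ i * s"
      using i by (simp add: M_def ext_def scalar_prod_def atLeast0LessThan)
    then show "(M t *\<^sub>v ext r s) $ i = (poly_act r (Z t) v + s \<cdot>\<^sub>v b t) $ i"
      using i poly_act_index[OF Z v r i, of t] carrier_vecD[OF b[of t]] dim_poly_act[OF Z v]
      by (simp add: mult.commute)
  qed (simp add: M_def b_def)
  have ext_0: "r = 0 \<and> s = 0" if r: "\<forall>i\<ge>k. coeff r i = 0" and e: "ext r s = 0\<^sub>v (Suc k)" for r s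
  proof -
    have *: "(if j < k then coeff r j else s) = 0" if "j < Suc k" for j
      using arg_cong[OF e, of "\<lambda>u. u $ j"] that by (simp add: ext_def)
    have "coeff r j = 0" for j
    proof (cases "j < k")
      case True
      then show ?thesis
        using *[of j] by simp
    qed (use r in simp)
    moreover have "s = 0"
      using *[of k] by simp
    ultimately show ?thesis
      by (simp add: poly_eq_iff)
  qed
  have "\<exists>t. t \<noteq> 0 \<and> (\<forall>c\<in>carrier_vec (Suc k). M t *\<^sub>v c = 0\<^sub>v n \<longrightarrow> c = 0\<^sub>v (Suc k))"
  proof (rule trivial_kernel_perturb)
    show "M t \<in> carrier_mat n (Suc k)" for t
      by (simp add: M_def)
    show "isCont (\<lambda>t. M t $$ (i, j)) 0" if "i < n" "j < Suc k" for i j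
      using that cont_Z[of i j] cont_b[of i] by (cases "j < k") (simp_all add: M_def)
    fix c :: "complex vec"
    assume c: "c \<in> carrier_vec (Suc k)" and Mc: "M 0 *\<^sub>v c = 0\<^sub>v n"
    obtain r where r: "\<forall>i\<ge>k. coeff r i = 0" "vec k (\<lambda>j. c $ j) = vec k (coeff r)"
      using vec_is_vec_coeff[of "vec k (\<lambda>j. c $ j)" k] by auto
    have cj: "c $ j = coeff r j" if "j < k" for j
      using arg_cong[OF r(2), of "\<lambda>u. u $ j"] that by simp
    define s where "s = c $ k"
    have c_eq: "c = ext r s"
      using c cj by (intro eq_vecI) (auto simp: ext_def s_def less_Suc_eq)
    have 0: "poly_act r X v + s \<cdot>\<^sub>v b 0 = 0\<^sub>v n"
      using M_ext[OF r(1), of 0 s] Mc unfolding c_eq Z0 by simp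
    \<comment> \<open>\<open>\<phi>\<close> kills the Krylov space of \<open>v\<close> but not
      \<open>b 0\<close>, so it isolates the coefficient \<open>s\<close>.\<close>
    have "\<phi> \<bullet> (poly_act r X v + s \<cdot>\<^sub>v b 0) = s * (\<phi> \<bullet> b 0)"
      using phi(1) b[of 0] poly_act_carrier[OF X v] kill
      by (subst scalar_prod_add_distrib[of _ n]) auto
    then have s0: "s = 0"
      using phi_b phi(1) unfolding 0 by simp
    have "s \<cdot>\<^sub>v b 0 = 0\<^sub>v n"
      unfolding s0 using carrier_vecD[OF b[of 0]] by (intro eq_vecI) simp_all
    with 0 have "poly_act r X v + 0\<^sub>v n = 0\<^sub>v n"
      by simp
    then have "poly_act r X v = 0\<^sub>v n"
      unfolding right_zero_vec[OF poly_act_carrier[OF X v]] .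
    then have "r = 0"
      using indep r(1) v by (auto simp: krylov_indep_def)
    then show "c = 0\<^sub>v (Suc k)"
      unfolding c_eq s0 by (intro eq_vecI) (auto simp: ext_def)
  qed
  then obtain t where "t \<noteq> 0"
    and inj: "\<And>c. c \<in> carrier_vec (Suc k) \<Longrightarrow> M t *\<^sub>v c = 0\<^sub>v n \<Longrightarrow> c = 0\<^sub>v (Suc k)"
    by blast
  have "h = 0" if h: "\<forall>i\<ge>Suc k. coeff h i = 0" "poly_act h (Z t) v = 0\<^sub>v n" for h
  proof -
    \<comment> \<open>Subtracting \<open>q f\<close> removes the coefficient of degree
      \<open>k\<close>. Then \<open>h(Z t) v = r(Z t) v + q t b(t)\<close>, a combination of the
      columns of \<open>M t\<close>.\<close>
    define q where "q = coeff h k / coeff f k"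
    define r where "r = h - smult q f"
    have r: "\<forall>i\<ge>k. coeff r i = 0"
    proof (intro allI impI)
      fix i assume "k \<le> i"
      then consider "i = k" | "Suc k \<le> i"
        by linarith
      then show "coeff r i = 0"
        by cases (use h(1) f(1,2) in \<open>simp_all add: r_def q_def\<close>)
    qed
    have "M t *\<^sub>v ext r (q * t) = 0\<^sub>v n"
      unfolding M_ext[OF r] unfolding r_def poly_act_diff[OF Z v] poly_act_smult[OF Z v] h(2) fb
      using b[of t] by (intro eq_vecI) auto
    moreover have "ext r (q * t) \<in> carrier_vec (Suc k)"
      by (simp add: ext_def)
    ultimately have "r = 0" "q * t = 0"
      using ext_0[OF r inj] by blast+
    then show ?thesis
      using \<open>t \<noteq> 0\<close> by (simp add: r_def)
  qed
  then show ?thesis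
    using v unfolding krylov_indep_def Z_def by auto
qed

subsection \<open>Pairs with rank-one defect\<close>

text \<open>The relation \<open>[X, Y] = I + v w\<^sup>T\<close> is stated through its action on
  vectors, the form in which it is applied to Krylov spaces.\<close>

locale calogero_moser =
  fixes n :: nat and X Y :: "complex mat" and v w :: "complex vec"
  assumes X [simp]: "X \<in> carrier_mat n n" and Y [simp]: "Y \<in> carrier_mat n n"
    and v [simp]: "v \<in> carrier_vec n" and w [simp]: "w \<in> carrier_vec n"
    and comm: "\<And>x. x \<in> carrier_vec n \<Longrightarrow>
      X *\<^sub>v (Y *\<^sub>v x) = Y *\<^sub>v (X *\<^sub>v x) + x + (w \<bullet> x) \<cdot>\<^sub>v v"
begin

lemma dims [simp]: "dim_row X = n" "dim_col X = n" "dim_row Y = n" "dim_col Y = n" "dim_vec v = n" "dim_vec w = n"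
  using carrier_matD[OF X] carrier_matD[OF Y] carrier_vecD[OF v] carrier_vecD[OF w] by simp_all

lemma X_vec [simp]: "x \<in> carrier_vec n \<Longrightarrow> X *\<^sub>v x \<in> carrier_vec n"
  and Y_vec [simp]: "x \<in> carrier_vec n \<Longrightarrow> Y *\<^sub>v x \<in> carrier_vec n"
  and Y_pow_vec [simp]: "x \<in> carrier_vec n \<Longrightarrow> Y ^\<^sub>m k *\<^sub>v x \<in> carrier_vec n"
  by (auto intro!: mult_mat_vec_carrier[of _ n n])

text \<open>The Leibniz rule for \<open>[X, Y^k]\<close>, paired with a row \<open>y\<close> and a
  column \<open>x\<close>: each of the \<open>k\<close> factors contributes one copy of
  \<open>I + v w\<^sup>T\<close>. At \<open>k = 0\<close> the truncated \<open>k - 1\<close> is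
  harmless because of the factor \<open>of_nat k\<close>.\<close>

lemma commute_power:
  assumes y: "y \<in> carrier_vec n" and "x \<in> carrier_vec n"
  shows "y \<bullet> (X *\<^sub>v (Y ^\<^sub>m k *\<^sub>v x)) = y \<bullet> (Y ^\<^sub>m k *\<^sub>v (X *\<^sub>v x))
    + of_nat k * (y \<bullet> (Y ^\<^sub>m (k - 1) *\<^sub>v x))
    + (\<Sum>i<k. (y \<bullet> (Y ^\<^sub>m i *\<^sub>v v)) * (w \<bullet> (Y ^\<^sub>m (k - 1 - i) *\<^sub>v x)))"
  using assms(2)
proof (induction k arbitrary: x)
  case 0
  then show ?case
    by (simp only: pow_mat_0_vec[OF Y] X_vec) simp
next
  case (Suc k)
  have "y \<bullet> (Y ^\<^sub>m k *\<^sub>v (X *\<^sub>v (Y *\<^sub>v x)))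
      = y \<bullet> (Y ^\<^sub>m k *\<^sub>v (Y *\<^sub>v (X *\<^sub>v x))) + y \<bullet> (Y ^\<^sub>m k *\<^sub>v x)
        + (w \<bullet> x) * (y \<bullet> (Y ^\<^sub>m k *\<^sub>v v))"
    unfolding comm[OF Suc.prems] using Suc.prems y
    by (simp add: mult_add_distrib_mat_vec[of _ n n] mult_mat_vec[of _ n n] scalar_prod_add_distrib[of _ n])
  moreover have "of_nat k * (y \<bullet> (Y ^\<^sub>m (k - 1) *\<^sub>v (Y *\<^sub>v x))) = of_nat k * (y \<bullet> (Y ^\<^sub>m k *\<^sub>v x))"
    using pow_mat_Suc_vec'[OF Y Suc.prems] by (cases k) auto
  moreover have "(\<Sum>i<k. (y \<bullet> (Y ^\<^sub>m i *\<^sub>v v)) * (w \<bullet> (Y ^\<^sub>m (k - 1 - i) *\<^sub>v (Y *\<^sub>v x))))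
      = (\<Sum>i<k. (y \<bullet> (Y ^\<^sub>m i *\<^sub>v v)) * (w \<bullet> (Y ^\<^sub>m (k - i) *\<^sub>v x)))"
  proof (intro sum.cong refl)
    fix i assume "i \<in> {..<k}"
    then have "k - i = Suc (k - 1 - i)"
      by auto
    then show "(y \<bullet> (Y ^\<^sub>m i *\<^sub>v v)) * (w \<bullet> (Y ^\<^sub>m (k - 1 - i) *\<^sub>v (Y *\<^sub>v x)))
        = (y \<bullet> (Y ^\<^sub>m i *\<^sub>v v)) * (w \<bullet> (Y ^\<^sub>m (k - i) *\<^sub>v x))"
      using pow_mat_Suc_vec'[OF Y Suc.prems] by metis
  qed
  ultimately show ?case
    using Suc.IH[of "Y *\<^sub>v x"] Suc.prems y pow_mat_0_vec[OF Y Suc.prems]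
    by (simp add: pow_mat_Suc_vec'[OF Y] algebra_simps del: pow_mat.simps)
qed

text \<open>If \<open>m\<close> is the least polynomial with \<open>m(Y)\<close> annihilated by \<open>\<phi>\<close>, then \<open>m'(Y)\<close> is annihilated
  as well, because \<open>m'(Y)\<close> is the commutator of \<open>X\<close> with \<open>m(Y)\<close> up to terms killed by \<open>\<phi>\<close>.\<close>

lemma no_left_eigenvector_killing_v:
  assumes phi: "\<phi> \<in> carrier_vec n" "X\<^sup>T *\<^sub>v \<phi> = \<mu> \<cdot>\<^sub>v \<phi>"
    and kill: "\<And>k. \<phi> \<bullet> (Y ^\<^sub>m k *\<^sub>v v) = 0"
  shows "\<phi> = 0\<^sub>v n"
proof (rule ccontr)
  assume "\<phi> \<noteq> 0\<^sub>v n"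
  \<comment> \<open>\<open>P m\<close> says that the row vector \<open>\<phi> m(Y)\<close> vanishes
    for a nonzero \<open>m\<close>.\<close>
  define P where "P m \<longleftrightarrow> m \<noteq> 0 \<and> (\<forall>x\<in>carrier_vec n. \<phi> \<bullet> poly_act m Y x = 0)" for m
  obtain m0 where "m0 \<noteq> 0" "poly_act m0 (Y\<^sup>T) \<phi> = 0\<^sub>v n"
    using ex_annihilating_poly[of "Y\<^sup>T" n \<phi>] phi(1) by auto
  then have "P m0"
    unfolding P_def using poly_act_transpose[OF Y _ phi(1), of _ m0] by auto
  then obtain m where "P m" and least: "\<And>p. P p \<Longrightarrow> degree m \<le> degree p"
    using ex_has_least_nat[of P m0 degree] by blast
  then have m: "m \<noteq> 0" "\<And>x. x \<in> carrier_vec n \<Longrightarrow> \<phi> \<bullet> poly_act m Y x = 0"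
    by (auto simp: P_def)
  have pd: "\<phi> \<bullet> poly_act (pderiv m) Y x = 0" if x: "x \<in> carrier_vec n" for x
  proof -
    let ?d = "degree m"
    have "\<phi> \<bullet> poly_act (pderiv m) Y x
        = (\<Sum>k<?d. of_nat (Suc k) * coeff m (Suc k) * (\<phi> \<bullet> (Y ^\<^sub>m k *\<^sub>v x)))"
      using x phi(1) by (subst scalar_prod_poly_act[OF Y, of _ _ ?d]) (auto simp: coeff_pderiv coeff_eq_0)
    also have "\<dots> = (\<Sum>k<Suc ?d. coeff m k * (of_nat k * (\<phi> \<bullet> (Y ^\<^sub>m (k - 1) *\<^sub>v x))))"
      by (subst sum.lessThan_Suc_shift) (simp add: mult_ac)
    also have "\<dots> = (\<Sum>k<Suc ?d. coeff m k * (\<mu> * (\<phi> \<bullet> (Y ^\<^sub>m k *\<^sub>v x)) - \<phi> \<bullet> (Y ^\<^sub>m k *\<^sub>v (X *\<^sub>v x))))"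
    proof (intro sum.cong refl)
      fix k
      have "\<phi> \<bullet> (X *\<^sub>v (Y ^\<^sub>m k *\<^sub>v x)) = \<mu> * (\<phi> \<bullet> (Y ^\<^sub>m k *\<^sub>v x))"
        using phi x by (simp add: scalar_prod_mat_vec[OF X])
      then have "of_nat k * (\<phi> \<bullet> (Y ^\<^sub>m (k - 1) *\<^sub>v x))
          = \<mu> * (\<phi> \<bullet> (Y ^\<^sub>m k *\<^sub>v x)) - \<phi> \<bullet> (Y ^\<^sub>m k *\<^sub>v (X *\<^sub>v x))"
        using commute_power[OF phi(1) x, of k] by (simp add: kill algebra_simps)
      then show "coeff m k * (of_nat k * (\<phi> \<bullet> (Y ^\<^sub>m (k - 1) *\<^sub>v x)))
          = coeff m k * (\<mu> * (\<phi> \<bullet> (Y ^\<^sub>m k *\<^sub>v x)) - \<phi> \<bullet> (Y ^\<^sub>m k *\<^sub>v (X *\<^sub>v x)))"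
        by (simp only:)
    qed
    also have "\<dots> = \<mu> * (\<phi> \<bullet> poly_act m Y x) - \<phi> \<bullet> poly_act m Y (X *\<^sub>v x)"
      using x phi(1)
      by (simp add: scalar_prod_poly_act[OF Y _ _, of _ _ "Suc ?d"] coeff_eq_0 sum_distrib_left
          sum_subtractf algebra_simps del: sum.lessThan_Suc)
    also have "\<dots> = 0"
      using m(2) x by simp
    finally show ?thesis .
  qed
  \<comment> \<open>A nonzero derivative would satisfy \<open>P\<close> with a degree below the
    minimum. Hence \<open>m\<close> is a nonzero constant and \<open>\<phi>\<close> itself is
    zero.\<close>
  have "pderiv m = 0"
  proof (rule ccontr)
    assume "pderiv m \<noteq> 0"
    then have "degree m \<le> degree (pderiv m)"
      using pd by (intro least) (auto simp: P_def)
    then have "degree m = 0"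
      using degree_pderiv[of m] by simp
    then show False
      using \<open>pderiv m \<noteq> 0\<close> pderiv_eq_0_iff by blast
  qed
  then obtain c where c: "m = [:c:]"
    by (auto simp: pderiv_eq_0_iff elim: degree_eq_zeroE)
  then have "c \<noteq> 0"
    using m(1) by simp
  have "\<phi> = 0\<^sub>v n"
  proof (rule eq_vecI)
    fix i assume "i < dim_vec (0\<^sub>v n :: complex vec)"
    then show "\<phi> $ i = 0\<^sub>v n $ i"
      using m(2)[of "unit_vec n i"] phi(1) \<open>c \<noteq> 0\<close> by (simp add: c poly_act_const[OF Y])
  qed (use phi in simp)
  with \<open>\<phi> \<noteq> 0\<^sub>v n\<close> show False ..
qed

text \<open>Transposing reverses products, and the sign on \<open>X\<^sup>T\<close> restores the
  order of the commutator. This exchanges \<open>v\<close> and \<open>w\<close>, so each result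
  about columns has a dual about rows.\<close>

lemma transpose: "calogero_moser n (- X\<^sup>T) (Y\<^sup>T) w v"
proof
  fix x :: "complex vec"
  assume x: "x \<in> carrier_vec n"
  have XT: "X\<^sup>T \<in> carrier_mat n n" and YT: "Y\<^sup>T \<in> carrier_mat n n"
    by simp_all
  have neg: "- X\<^sup>T *\<^sub>v y = - (X\<^sup>T *\<^sub>v y)" if "y \<in> carrier_vec n" for y
    by (rule uminus_mult_mat_vec) (use that in simp)
  have neg': "Y\<^sup>T *\<^sub>v - y = - (Y\<^sup>T *\<^sub>v y)" if "y \<in> carrier_vec n" for y
    using that mult_mat_vec[OF YT that, of "-1"] by (auto intro!: eq_vecI)
  show "- X\<^sup>T *\<^sub>v (Y\<^sup>T *\<^sub>v x) = Y\<^sup>T *\<^sub>v (- X\<^sup>T *\<^sub>v x) + x + (v \<bullet> x) \<cdot>\<^sub>v w"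
  proof (rule vec_eq_if_scalar_prod_eq[of _ n])
    fix z :: "complex vec"
    assume z: "z \<in> carrier_vec n"
    have YTx: "Y\<^sup>T *\<^sub>v x \<in> carrier_vec n" and XTx: "X\<^sup>T *\<^sub>v x \<in> carrier_vec n"
      using x by (auto intro!: mult_mat_vec_carrier[of _ n n])
    then have XYTx: "X\<^sup>T *\<^sub>v (Y\<^sup>T *\<^sub>v x) \<in> carrier_vec n" and YXTx: "Y\<^sup>T *\<^sub>v (X\<^sup>T *\<^sub>v x) \<in> carrier_vec n"
      by (auto intro!: mult_mat_vec_carrier[of _ n n])
    have 1: "z \<bullet> (X\<^sup>T *\<^sub>v (Y\<^sup>T *\<^sub>v x)) = x \<bullet> (Y *\<^sub>v (X *\<^sub>v z))"
    proof -
      have "z \<bullet> (X\<^sup>T *\<^sub>v (Y\<^sup>T *\<^sub>v x)) = (X *\<^sub>v z) \<bullet> (Y\<^sup>T *\<^sub>v x)"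
        using scalar_prod_mat_vec[OF XT YTx z] by simp
      also have "\<dots> = (Y *\<^sub>v (X *\<^sub>v z)) \<bullet> x"
        using scalar_prod_mat_vec[OF YT x, of "X *\<^sub>v z"] z by simp
      also have "\<dots> = x \<bullet> (Y *\<^sub>v (X *\<^sub>v z))"
        using x z by (intro comm_scalar_prod[of _ n]) auto
      finally show ?thesis .
    qed
    have 2: "z \<bullet> (Y\<^sup>T *\<^sub>v (X\<^sup>T *\<^sub>v x)) = x \<bullet> (X *\<^sub>v (Y *\<^sub>v z))"
    proof -
      have "z \<bullet> (Y\<^sup>T *\<^sub>v (X\<^sup>T *\<^sub>v x)) = (Y *\<^sub>v z) \<bullet> (X\<^sup>T *\<^sub>v x)"
        using scalar_prod_mat_vec[OF YT XTx z] by simp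
      also have "\<dots> = (X *\<^sub>v (Y *\<^sub>v z)) \<bullet> x"
        using scalar_prod_mat_vec[OF XT x, of "Y *\<^sub>v z"] z by simp
      also have "\<dots> = x \<bullet> (X *\<^sub>v (Y *\<^sub>v z))"
        using x z by (intro comm_scalar_prod[of _ n]) auto
      finally show ?thesis .
    qed
    have 3: "x \<bullet> (X *\<^sub>v (Y *\<^sub>v z)) = x \<bullet> (Y *\<^sub>v (X *\<^sub>v z)) + z \<bullet> x + (v \<bullet> x) * (z \<bullet> w)"
      unfolding comm[OF z] using x z
      by (simp add: scalar_prod_add_distrib[of _ n] comm_scalar_prod[of x n] comm_scalar_prod[of w n])
    show "z \<bullet> (- X\<^sup>T *\<^sub>v (Y\<^sup>T *\<^sub>v x)) = z \<bullet> (Y\<^sup>T *\<^sub>v (- X\<^sup>T *\<^sub>v x) + x + (v \<bullet> x) \<cdot>\<^sub>v w)"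
      unfolding neg[OF YTx] neg[OF x] neg'[OF XTx] using x z XYTx YXTx 3
      by (simp add: scalar_prod_add_distrib[of _ n] 1 2)
  qed (auto intro!: carrier_vecI)
qed auto

text \<open>The dual of \<open>no_left_eigenvector_killing_v\<close>, obtained from the transposed
  pair with eigenvalue \<open>- \<mu>\<close>.\<close>

lemma no_right_eigenvector_killing_w:
  assumes u: "u \<in> carrier_vec n" "X *\<^sub>v u = \<mu> \<cdot>\<^sub>v u"
    and kill: "\<And>k. w \<bullet> (Y ^\<^sub>m k *\<^sub>v u) = 0"
  shows "u = 0\<^sub>v n"
proof -
  interpret T: calogero_moser n "- X\<^sup>T" "Y\<^sup>T" w v
    by (rule transpose)
  have pow: "(Y\<^sup>T) ^\<^sub>m k = (Y ^\<^sub>m k)\<^sup>T" for k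
  proof (induction k)
    case (Suc k)
    then show ?case
      unfolding pow_mat_Suc_left[OF Y] using transpose_mult[OF Y pow_carrier_mat[OF Y, of k]] by simp
  qed (use carrier_matD[OF Y] in simp)
  show ?thesis
  proof (rule T.no_left_eigenvector_killing_v)
    show "(- X\<^sup>T)\<^sup>T *\<^sub>v u = (- \<mu>) \<cdot>\<^sub>v u"
    proof -
      have "- X *\<^sub>v u = - (X *\<^sub>v u)"
        by (rule uminus_mult_mat_vec) (use u in simp)
      then show ?thesis
        using u by (auto simp: transpose_uminus intro!: eq_vecI)
    qed
    show "u \<bullet> ((Y\<^sup>T) ^\<^sub>m k *\<^sub>v w) = 0" for k
    proof -
      have "u \<bullet> ((Y\<^sup>T) ^\<^sub>m k *\<^sub>v w) = ((Y ^\<^sub>m k)\<^sup>T *\<^sub>v w) \<bullet> u"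
        unfolding pow by (rule comm_scalar_prod[of _ n]) (use u in \<open>auto intro!: mult_mat_vec_carrier[of _ n n]\<close>)
      also have "\<dots> = w \<bullet> (Y ^\<^sub>m k *\<^sub>v u)"
        using u by (intro transpose_vec_mult_scalar) auto
      finally show ?thesis
        using kill by simp
    qed
  qed fact
qed

text \<open>The commutator has trace zero, while \<open>I + v w\<^sup>T\<close> has trace
  \<open>n + w \<bullet> v\<close>.\<close>

lemma trace_identity: "w \<bullet> v = - of_nat n"
proof -
  have *: "(X *\<^sub>v (Y *\<^sub>v unit_vec n i)) $ i = (\<Sum>j<n. X $$ (i, j) * Y $$ (j, i))"
    "(Y *\<^sub>v (X *\<^sub>v unit_vec n i)) $ i = (\<Sum>j<n. Y $$ (i, j) * X $$ (j, i))" if "i < n" for i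
    using that carrier_matD[OF X] carrier_matD[OF Y]
    by (simp_all add: scalar_prod_def atLeast0LessThan if_distrib[of "\<lambda>u. _ * u"] cong: if_cong)
  have "(\<Sum>j<n. X $$ (i, j) * Y $$ (j, i)) = (\<Sum>j<n. Y $$ (i, j) * X $$ (j, i)) + 1 + w $ i * v $ i"
    if "i < n" for i
    using arg_cong[OF comm[of "unit_vec n i"], of "\<lambda>u. u $ i"] that *[OF that]
      carrier_matD[OF X] carrier_matD[OF Y] carrier_vecD[OF v] by simp
  then have "(\<Sum>i<n. \<Sum>j<n. X $$ (i, j) * Y $$ (j, i))
      = (\<Sum>i<n. \<Sum>j<n. Y $$ (i, j) * X $$ (j, i)) + of_nat n + (\<Sum>i<n. w $ i * v $ i)"
    by (simp add: sum.distrib)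
  moreover have "(\<Sum>i<n. \<Sum>j<n. X $$ (i, j) * Y $$ (j, i)) = (\<Sum>i<n. \<Sum>j<n. Y $$ (i, j) * X $$ (j, i))"
    by (subst sum.swap) (simp add: mult.commute)
  ultimately have "(\<Sum>i<n. w $ i * v $ i) = - of_nat n"
    by (simp add: eq_neg_iff_add_eq_0 add.commute)
  then show ?thesis
    using carrier_vecD[OF v] by (simp add: scalar_prod_def atLeast0LessThan)
qed

end

subsection \<open>Reaching a cyclic vector\<close>

lemma mat_poly_eval_add:
  assumes A: "A \<in> carrier_mat n n"
  shows "mat_poly_eval n (p + q) A = mat_poly_eval n p A + mat_poly_eval n q A"
proof (rule mat_eq_if_vec_eq[of _ n])
  fix x :: "complex vec" assume x: "x \<in> carrier_vec n"
  show "mat_poly_eval n (p + q) A *\<^sub>v x = (mat_poly_eval n p A + mat_poly_eval n q A) *\<^sub>v x"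
    unfolding add_mult_distrib_mat_vec[OF mat_poly_eval_carrier[OF A] mat_poly_eval_carrier[OF A] x]
      mat_poly_eval_vec[OF x] by (rule poly_act_add[OF A x])
qed (use A in auto)

lemma mat_poly_eval_monom:
  assumes A: "A \<in> carrier_mat n n"
  shows "mat_poly_eval n (monom c k) A = c \<cdot>\<^sub>m (A ^\<^sub>m k)"
proof (rule mat_eq_if_vec_eq[of _ n])
  fix x :: "complex vec" assume x: "x \<in> carrier_vec n"
  show "mat_poly_eval n (monom c k) A *\<^sub>v x = (c \<cdot>\<^sub>m (A ^\<^sub>m k)) *\<^sub>v x"
    unfolding mat_poly_eval_vec[OF x] poly_act_monom[OF A x]
    using A x by (intro eq_vecI) auto
qed (use A in auto)

context calogero_moser
begin

text \<open>A summand commuting with \<open>Y\<close> leaves the commutator unchanged, so the same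
  \<open>v\<close> and \<open>w\<close> serve the new pair.\<close>

lemma add_left:
  assumes P: "P \<in> carrier_mat n n"
    and commute: "\<And>x. x \<in> carrier_vec n \<Longrightarrow> P *\<^sub>v (Y *\<^sub>v x) = Y *\<^sub>v (P *\<^sub>v x)"
  shows "calogero_moser n (X + P) Y v w"
proof
  fix x :: "complex vec"
  assume x: "x \<in> carrier_vec n"
  have Px: "P *\<^sub>v x \<in> carrier_vec n" "P *\<^sub>v (Y *\<^sub>v x) \<in> carrier_vec n"
    using P x by (auto intro!: mult_mat_vec_carrier[of _ n n])
  have "(X + P) *\<^sub>v (Y *\<^sub>v x) = (Y *\<^sub>v (X *\<^sub>v x) + x + (w \<bullet> x) \<cdot>\<^sub>v v) + Y *\<^sub>v (P *\<^sub>v x)"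
    using x by (simp add: add_mult_distrib_mat_vec[OF X P] comm commute)
  also have "\<dots> = (Y *\<^sub>v (X *\<^sub>v x) + Y *\<^sub>v (P *\<^sub>v x)) + x + (w \<bullet> x) \<cdot>\<^sub>v v"
    using carrier_matD[OF Y] carrier_vecD[OF x] carrier_vecD[OF v] by (intro eq_vecI) auto
  also have "Y *\<^sub>v (X *\<^sub>v x) + Y *\<^sub>v (P *\<^sub>v x) = Y *\<^sub>v ((X + P) *\<^sub>v x)"
    using x Px by (simp add: add_mult_distrib_mat_vec[OF X P x] mult_add_distrib_mat_vec[OF Y])
  finally show "(X + P) *\<^sub>v (Y *\<^sub>v x) = Y *\<^sub>v ((X + P) *\<^sub>v x) + x + (w \<bullet> x) \<cdot>\<^sub>v v" .
qed (use P in auto)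

lemma diff_right:
  assumes Q: "Q \<in> carrier_mat n n"
    and commute: "\<And>x. x \<in> carrier_vec n \<Longrightarrow> X *\<^sub>v (Q *\<^sub>v x) = Q *\<^sub>v (X *\<^sub>v x)"
  shows "calogero_moser n X (Y - Q) v w"
proof
  fix x :: "complex vec"
  assume x: "x \<in> carrier_vec n"
  have Qx: "Q *\<^sub>v x \<in> carrier_vec n" "Q *\<^sub>v (X *\<^sub>v x) \<in> carrier_vec n"
    using Q x by (auto intro!: mult_mat_vec_carrier[of _ n n])
  have "X *\<^sub>v ((Y - Q) *\<^sub>v x) = (Y *\<^sub>v (X *\<^sub>v x) + x + (w \<bullet> x) \<cdot>\<^sub>v v) - Q *\<^sub>v (X *\<^sub>v x)"
    using x Qx by (simp add: minus_mult_distrib_mat_vec[OF Y Q] mult_minus_distrib_mat_vec[OF X] comm commute)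
  also have "\<dots> = (Y *\<^sub>v (X *\<^sub>v x) - Q *\<^sub>v (X *\<^sub>v x)) + x + (w \<bullet> x) \<cdot>\<^sub>v v"
    using carrier_matD[OF Q] carrier_matD[OF Y] carrier_vecD[OF x] carrier_vecD[OF v]
    by (intro eq_vecI) auto
  also have "Y *\<^sub>v (X *\<^sub>v x) - Q *\<^sub>v (X *\<^sub>v x) = (Y - Q) *\<^sub>v (X *\<^sub>v x)"
    using x by (simp add: minus_mult_distrib_mat_vec[OF Y Q])
  finally show "X *\<^sub>v ((Y - Q) *\<^sub>v x) = (Y - Q) *\<^sub>v (X *\<^sub>v x) + x + (w \<bullet> x) \<cdot>\<^sub>v v" .
qed (use Q in auto)

lemma mat_poly_eval_commute:
  assumes "A \<in> carrier_mat n n" "x \<in> carrier_vec n"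
  shows "mat_poly_eval n p A *\<^sub>v (A *\<^sub>v x) = A *\<^sub>v (mat_poly_eval n p A *\<^sub>v x)"
  using assms poly_act_mat_vec[OF assms]
  by (simp add: mat_poly_eval_vec mat_poly_eval_vec[OF mult_mat_vec_carrier[OF assms]])

lemma add_poly: "calogero_moser n (X + mat_poly_eval n p Y) Y v w"
  by (rule add_left) (auto simp: mat_poly_eval_commute)

lemma diff_poly: "calogero_moser n X (Y - mat_poly_eval n p X) v w"
  by (rule diff_right) (auto simp: mat_poly_eval_commute)

lemma krylov_indep_step:
  assumes indep: "krylov_indep k X v" and "k < n"
  shows "\<exists>j t. krylov_indep (Suc k) (X + t \<cdot>\<^sub>m (Y ^\<^sub>m j)) v"
proof (cases "krylov_indep (Suc k) X v")
  case True
  have "X + 0 \<cdot>\<^sub>m (Y ^\<^sub>m 0) = X"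
    using carrier_matD[OF X] carrier_matD[OF Y] by (intro eq_matI) auto
  with True show ?thesis
    by metis
next
  case False
  then obtain f where f: "\<forall>i\<ge>Suc k. coeff f i = 0" "poly_act f X v = 0\<^sub>v n" "f \<noteq> 0"
    using carrier_vecD[OF v] by (auto simp: krylov_indep_def)
  have fk: "coeff f k \<noteq> 0"
  proof
    assume "coeff f k = 0"
    then have "\<forall>i\<ge>k. coeff f i = 0"
      using f(1) by (metis le_antisym not_less_eq_eq)
    then show False
      using f(2,3) indep carrier_vecD[OF v] by (auto simp: krylov_indep_def)
  qed
  have degf: "degree f = k"
    using fk f(1) by (metis le_antisym le_degree leading_coeff_0_iff not_less_eq_eq f(3))
  \<comment> \<open>Since \<open>k < n\<close>, some nonzero row vector is orthogonal to the first
    \<open>k\<close> Krylov vectors.\<close>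
  have "(krylov_mat n k X v)\<^sup>T \<in> carrier_mat k n"
    by simp
  from wide_matrix_kernel[OF this \<open>k < n\<close>]
  obtain \<phi>0 where phi0: "\<phi>0 \<in> carrier_vec n" "\<phi>0 \<noteq> 0\<^sub>v n"
      "(krylov_mat n k X v)\<^sup>T *\<^sub>v \<phi>0 = 0\<^sub>v k"
    by blast
  have kill0: "\<phi>0 \<bullet> (X ^\<^sub>m j *\<^sub>v v) = 0" if "j < k" for j
  proof -
    have "col (krylov_mat n k X v) j = X ^\<^sub>m j *\<^sub>v v"
      using that carrier_vecD[OF pow_mat_vec_carrier[OF X v, of j]]
      by (intro eq_vecI) (auto simp: krylov_mat_def)
    then have "((krylov_mat n k X v)\<^sup>T *\<^sub>v \<phi>0) $ j = (X ^\<^sub>m j *\<^sub>v v) \<bullet> \<phi>0"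
      using that by (simp add: krylov_mat_def)
    also have "\<dots> = \<phi>0 \<bullet> (X ^\<^sub>m j *\<^sub>v v)"
      by (rule comm_scalar_prod[OF pow_mat_vec_carrier[OF X v] phi0(1)])
    finally have "\<phi>0 \<bullet> (X ^\<^sub>m j *\<^sub>v v) = ((krylov_mat n k X v)\<^sup>T *\<^sub>v \<phi>0) $ j" ..
    then show ?thesis
      using phi0(3) that by simp
  qed
  \<comment> \<open>As \<open>f(X) v = 0\<close> with \<open>degree f = k\<close>, reduction modulo
    \<open>f\<close> leaves only the first \<open>k\<close> powers of \<open>X\<close>.\<close>
  have kill1: "\<phi>0 \<bullet> poly_act p X v = 0" for p
  proof -
    have "poly_act ((p div f) * f) X v = 0\<^sub>v n"
      unfolding poly_act_mult[OF X v] f(2) by (rule poly_act_zero_vec[OF X])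
    then have "poly_act p X v = poly_act (p mod f) X v"
      using poly_act_add[OF X v, of "(p div f) * f" "p mod f"] poly_act_carrier[OF X v] by simp
    moreover have "\<forall>i\<ge>k. coeff (p mod f) i = 0"
      using degree_mod_less[OF f(3), of p] degf by (auto intro: coeff_eq_0)
    ultimately show ?thesis
      using scalar_prod_poly_act[OF X v phi0(1)] kill0 by simp
  qed
  have XT: "X\<^sup>T \<in> carrier_mat n n"
    by simp
  \<comment> \<open>Replacing \<open>\<phi>0\<close> by an eigenvector of the form
    \<open>h(X\<^sup>T) \<phi>0\<close> is safe: \<open>h\<close> moves to the other side of the
    pairing, where \<open>kill1\<close> applies to \<open>h * p\<close>.\<close>
  obtain h \<mu> where h: "poly_act h (X\<^sup>T) \<phi>0 \<noteq> 0\<^sub>v n"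
      "X\<^sup>T *\<^sub>v poly_act h (X\<^sup>T) \<phi>0 = \<mu> \<cdot>\<^sub>v poly_act h (X\<^sup>T) \<phi>0"
    using poly_act_eigenvector[OF XT phi0(1,2)] by blast
  define \<phi> where "\<phi> = poly_act h (X\<^sup>T) \<phi>0"
  have phi: "\<phi> \<in> carrier_vec n" "\<phi> \<noteq> 0\<^sub>v n" "X\<^sup>T *\<^sub>v \<phi> = \<mu> \<cdot>\<^sub>v \<phi>"
    using h poly_act_carrier[OF XT phi0(1)] by (simp_all add: \<phi>_def)
  have kill: "\<phi> \<bullet> poly_act p X v = 0" for p
    unfolding \<phi>_def using poly_act_transpose[OF X poly_act_carrier[OF X v] phi0(1), of h p]
      poly_act_mult[OF X v, of h p] kill1[of "h * p"] by simp
  define g where "g = synthetic_div f \<mu>"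
  define u where "u = poly_act g X v"
  have u: "u \<in> carrier_vec n"
    unfolding u_def by (rule poly_act_carrier[OF X v])
  show ?thesis
  proof (rule ccontr)
    assume *: "\<not> ?thesis"
    \<comment> \<open>The contrapositive of the perturbation lemma for the direction
      \<open>Y^j\<close>.\<close>
    have \<gamma>: "\<phi> \<bullet> (Y ^\<^sub>m j *\<^sub>v u) = 0" for j
      using krylov_indep_perturb[OF X pow_carrier_mat[OF Y, of j] v indep f(1) fk f(2) phi(1,3) kill] *
      unfolding u_def g_def by blast
    define \<alpha> where "\<alpha> i = \<phi> \<bullet> (Y ^\<^sub>m i *\<^sub>v v)" for i
    define \<beta> where "\<beta> i = w \<bullet> (Y ^\<^sub>m i *\<^sub>v u)" for i
    let ?c = "poly f \<mu>"
    \<comment> \<open>This is \<open>f = (x - \<mu>) g + f(\<mu>)\<close>, evaluated at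
      \<open>X\<close> and applied to \<open>v\<close>.\<close>
    have Xu: "X *\<^sub>v u = \<mu> \<cdot>\<^sub>v u - ?c \<cdot>\<^sub>v v"
    proof -
      have "poly_act ([:- \<mu>, 1:] * g + [:?c:]) X v = 0\<^sub>v n"
        unfolding g_def synthetic_div_correct' by (rule f(2))
      then have 0: "(- \<mu>) \<cdot>\<^sub>v u + X *\<^sub>v u + ?c \<cdot>\<^sub>v v = 0\<^sub>v n"
        using poly_act_add[OF X v, of "[:- \<mu>, 1:] * g" "[:?c:]"] poly_act_mult[OF X v, of "[:- \<mu>, 1:]" g]
          poly_act_pCons[OF X u, of "- \<mu>" 1] poly_act_1[OF X u] poly_act_const[OF X v, of ?c]
        by (simp add: u_def[symmetric] pCons_one)
      show ?thesis
      proof (rule eq_vecI)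
        fix i assume "i < dim_vec (\<mu> \<cdot>\<^sub>v u - ?c \<cdot>\<^sub>v v)"
        then have i: "i < n"
          by simp
        have "- \<mu> * u $ i + (X *\<^sub>v u) $ i + ?c * v $ i = 0"
          using arg_cong[OF 0, of "\<lambda>z. z $ i"] i carrier_vecD[OF u] by simp
        then have "(X *\<^sub>v u) $ i = \<mu> * u $ i - ?c * v $ i"
          by (simp add: algebra_simps eq_diff_eq add_eq_0_iff2)
        then show "(X *\<^sub>v u) $ i = (\<mu> \<cdot>\<^sub>v u - ?c \<cdot>\<^sub>v v) $ i"
          using i carrier_vecD[OF u] by simp
      qed simp
    qed
    \<comment> \<open>Compare coefficients in \<open>commute_power\<close>: by
      \<open>\<gamma>\<close> all pairings of \<open>\<phi>\<close> with \<open>Y^i u\<close> drop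
      out, leaving \<open>f(\<mu>)\<close> times \<alpha> on one side and the convolution on the
      other.\<close>
    have conv: "?c * \<alpha> j = (\<Sum>i<j. \<alpha> i * \<beta> (j - 1 - i))" for j
    proof -
      have "\<phi> \<bullet> (X *\<^sub>v (Y ^\<^sub>m j *\<^sub>v u)) = \<mu> * (\<phi> \<bullet> (Y ^\<^sub>m j *\<^sub>v u))"
        using phi u by (simp add: scalar_prod_mat_vec[OF X])
      moreover have "\<phi> \<bullet> (Y ^\<^sub>m j *\<^sub>v (X *\<^sub>v u)) = - (?c * \<alpha> j)"
        unfolding Xu \<alpha>_def using u phi(1) \<gamma>[of j]
        by (simp add: mult_minus_distrib_mat_vec[of _ n n] mult_mat_vec[of _ n n]
            scalar_prod_minus_distrib[of _ n])
      ultimately show ?thesis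
        using commute_power[OF phi(1) u, of j] by (simp add: \<gamma> \<alpha>_def \<beta>_def eq_neg_iff_add_eq_0)
    qed
    have \<alpha>0: "\<not> (\<forall>i. \<alpha> i = 0)"
      using no_left_eigenvector_killing_v[OF phi(1,3)] phi(2) unfolding \<alpha>_def by blast
    show False
    proof (cases "?c = 0")
      case False
      \<comment> \<open>The convolution for \<open>j\<close> involves only \<alpha>(i) with
        \<open>i < j\<close>, so strong induction applies.\<close>
      have "\<alpha> j = 0" for j
      proof (induction j rule: less_induct)
        case (less j)
        then show ?case
          using conv[of j] False by simp
      qed
      with \<alpha>0 show False
        by blast
    next
      case True
      \<comment> \<open>The coefficient \<open>j\<close> of the product is \<open>conv\<close> at
        \<open>Suc j\<close>. Formal power series over the complex numbers have no zero divisors, so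
        one factor vanishes.\<close>
      have "Abs_fps \<alpha> * Abs_fps \<beta> = 0"
      proof (rule fps_ext)
        fix j
        have "fps_nth (Abs_fps \<alpha> * Abs_fps \<beta>) j = (\<Sum>i<Suc j. \<alpha> i * \<beta> (Suc j - 1 - i))"
          unfolding fps_mult_nth fps_nth_Abs_fps by (intro sum.cong) auto
        also have "\<dots> = fps_nth 0 j"
          unfolding conv[symmetric] True by simp
        finally show "fps_nth (Abs_fps \<alpha> * Abs_fps \<beta>) j = fps_nth 0 j" .
      qed
      then have "Abs_fps \<alpha> = 0 \<or> Abs_fps \<beta> = 0"
        by simp
      moreover have "Abs_fps \<alpha> \<noteq> 0"
        using \<alpha>0 by (auto simp: fps_eq_iff)
      ultimately have "\<beta> i = 0" for i
        using fps_nth_Abs_fps[of \<beta> i] by auto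
      moreover have "X *\<^sub>v u = \<mu> \<cdot>\<^sub>v u"
        unfolding Xu True using u carrier_vecD[OF v] by (intro eq_vecI) auto
      ultimately have "u = 0\<^sub>v n"
        using no_right_eigenvector_killing_w[OF u] unfolding \<beta>_def by blast
      \<comment> \<open>Division by a linear factor lowers the degree below \<open>k\<close>, so
        \<open>g(X) v = 0\<close> contradicts the independence of the first \<open>k\<close> Krylov
        vectors unless \<open>g = 0\<close>.\<close>
      moreover have "\<forall>i\<ge>k. coeff g i = 0"
      proof (intro allI impI)
        fix i assume "k \<le> i"
        have "coeff f (Suc i) = coeff g i - \<mu> * coeff g (Suc i)"
          using arg_cong[OF synthetic_div_correct'[of \<mu> f], of "\<lambda>p. coeff p (Suc i)"]
          by (simp add: g_def)
        moreover have "coeff g (Suc i) = 0"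
          using coeff_synthetic_div_eq_0[OF f(1), of \<mu>] \<open>k \<le> i\<close> by (simp add: g_def)
        ultimately show "coeff g i = 0"
          using f(1) \<open>k \<le> i\<close> by simp
      qed
      ultimately have "g = 0"
        using indep carrier_vecD[OF v] unfolding u_def krylov_indep_def by auto
      then have "f = 0"
        using synthetic_div_correct'[of \<mu> f] True by (simp add: g_def)
      with f(3) show False ..
    qed
  qed
qed

end

text \<open>Each application of \<open>krylov_indep_step\<close> adds a monomial in
  \<open>Y\<close>; as \<open>v\<close> and \<open>w\<close> stay fixed, the steps can be iterated
  and collected into one polynomial.\<close>

lemma (in calogero_moser) ex_cyclic: "\<exists>p. krylov_indep n (X + mat_poly_eval n p Y) v"
proof -
  have "\<exists>p. krylov_indep k (X + mat_poly_eval n p Y) v" if "k \<le> n" for k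
    using that
  proof (induction k)
    case 0
    show ?case
      by (simp add: krylov_indep_def poly_eq_iff)
  next
    case (Suc k)
    then obtain p where p: "krylov_indep k (X + mat_poly_eval n p Y) v"
      by auto
    interpret X': calogero_moser n "X + mat_poly_eval n p Y" Y v w
      by (rule add_poly)
    obtain j t where "krylov_indep (Suc k) (X + mat_poly_eval n p Y + t \<cdot>\<^sub>m (Y ^\<^sub>m j)) v"
      using X'.krylov_indep_step[OF p] Suc.prems by auto
    also have "X + mat_poly_eval n p Y + t \<cdot>\<^sub>m (Y ^\<^sub>m j) = X + mat_poly_eval n (p + monom t j) Y"
      unfolding mat_poly_eval_add[OF Y] mat_poly_eval_monom[OF Y] using X Y
      by (intro assoc_add_mat[of _ n n]) auto
    finally show ?case
      by blast
  qed
  then show ?thesis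
    by blast
qed

subsection \<open>The canonical pair\<close>

text \<open>The matrix of \<open>X\<close> on the rows \<open>w Y^k\<close> when
  \<open>w X = 0\<close> and \<open>Y v = 0\<close>; the subdiagonal entries are forced by the
  commutation relation and \<open>trace_identity\<close>.\<close>

definition canonical_X :: "nat \<Rightarrow> complex mat" where
  "canonical_X n = mat n n (\<lambda>(k, l). if k = Suc l then of_nat n - of_nat k else 0)"

text \<open>The nilpotent shift: multiplying \<open>w Y^k\<close> by \<open>Y\<close> gives the next
  row, and the last one goes to zero.\<close>

definition canonical_Y :: "nat \<Rightarrow> complex mat" where
  "canonical_Y n = mat n n (\<lambda>(k, l). if l = Suc k then 1 else 0)"

context calogero_moser
begin

lemma comm_transpose:
  assumes x: "x \<in> carrier_vec n"
  shows "X\<^sup>T *\<^sub>v (Y\<^sup>T *\<^sub>v x) = Y\<^sup>T *\<^sub>v (X\<^sup>T *\<^sub>v x) - x - (v \<bullet> x) \<cdot>\<^sub>v w"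
proof -
  interpret T: calogero_moser n "- X\<^sup>T" "Y\<^sup>T" w v
    by (rule transpose)
  have neg: "- X\<^sup>T *\<^sub>v y = - (X\<^sup>T *\<^sub>v y)" if "y \<in> carrier_vec n" for y
    by (rule uminus_mult_mat_vec) (use that in simp)
  have Xx: "X\<^sup>T *\<^sub>v x \<in> carrier_vec n" and Yx: "Y\<^sup>T *\<^sub>v x \<in> carrier_vec n"
    by (rule carrier_vecI, simp)+
  have YXx: "Y\<^sup>T *\<^sub>v - (X\<^sup>T *\<^sub>v x) = - (Y\<^sup>T *\<^sub>v (X\<^sup>T *\<^sub>v x))"
    using mult_mat_vec[OF T.Y Xx, of "-1"] by (auto intro!: eq_vecI)
  show ?thesis
  proof (rule eq_vecI)
    fix i assume "i < dim_vec (Y\<^sup>T *\<^sub>v (X\<^sup>T *\<^sub>v x) - x - (v \<bullet> x) \<cdot>\<^sub>v w)"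
    then have i: "i < n"
      by simp
    have "- (X\<^sup>T *\<^sub>v (Y\<^sup>T *\<^sub>v x)) $ i = - (Y\<^sup>T *\<^sub>v (X\<^sup>T *\<^sub>v x)) $ i + x $ i + (v \<bullet> x) * w $ i"
      using arg_cong[OF T.comm[OF x], of "\<lambda>z. z $ i"] i carrier_vecD[OF x]
      unfolding neg[OF x] neg[OF Yx] YXx by simp
    then have "(X\<^sup>T *\<^sub>v (Y\<^sup>T *\<^sub>v x)) $ i = (Y\<^sup>T *\<^sub>v (X\<^sup>T *\<^sub>v x)) $ i - x $ i - (v \<bullet> x) * w $ i"
      by (simp only: minus_equation_iff[of "(X\<^sup>T *\<^sub>v (Y\<^sup>T *\<^sub>v x)) $ i"]) simp
    then show "(X\<^sup>T *\<^sub>v (Y\<^sup>T *\<^sub>v x)) $ i = (Y\<^sup>T *\<^sub>v (X\<^sup>T *\<^sub>v x) - x - (v \<bullet> x) \<cdot>\<^sub>v w) $ i"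
      using i carrier_vecD[OF x] by simp
  qed simp
qed

section \<open>Y as a lowering operator on the Krylov basis of X\<close>

text \<open>Pushing \<open>Y\<close> through \<open>X\<close> by
  \<open>Y X = X Y - I - v w\<^sup>T\<close> until it meets \<open>v\<close> lowers the degree by
  one. The restriction \<open>degree h \<le> Suc i\<close> singles out the top coefficient and the
  zeros above it; the lower coefficients depend on the pairings of \<open>w\<close> with the Krylov
  vectors.\<close>

lemma lowering:
  assumes Yv: "Y *\<^sub>v v = 0\<^sub>v n"
  shows "\<exists>h'. Y *\<^sub>v poly_act h X v = poly_act h' X v \<and>
    (\<forall>i. degree h \<le> Suc i \<longrightarrow> coeff h' i = (of_nat n - of_nat (Suc i)) * coeff h (Suc i))"
proof (induction h)
  case 0
  have "Y *\<^sub>v 0\<^sub>v n = 0\<^sub>v n"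
    by (intro eq_vecI) auto
  then show ?case
    by (intro exI[of _ 0]) (simp add: poly_act_0[OF X v])
next
  case (pCons a h)
  then obtain h' where h': "Y *\<^sub>v poly_act h X v = poly_act h' X v"
    "\<And>i. degree h \<le> Suc i \<Longrightarrow> coeff h' i = (of_nat n - of_nat (Suc i)) * coeff h (Suc i)"
    by blast
  let ?x = "poly_act h X v"
  \<comment> \<open>The three terms mirror \<open>X Y\<close>, \<open>- I\<close> and
    \<open>- v w\<^sup>T\<close> applied to \<open>?x\<close>.\<close>
  define h'' where "h'' = pCons 0 h' - h - [:w \<bullet> ?x:]"
  have x: "?x \<in> carrier_vec n"
    by (rule poly_act_carrier[OF X v])
  have c: "X *\<^sub>v poly_act h' X v = Y *\<^sub>v (X *\<^sub>v ?x) + ?x + (w \<bullet> ?x) \<cdot>\<^sub>v v"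
    using comm[OF x] unfolding h'(1) .
  have eq: "Y *\<^sub>v poly_act (pCons a h) X v = poly_act h'' X v"
  proof (rule eq_vecI)
    fix i assume "i < dim_vec (poly_act h'' X v)"
    then have i: "i < n"
      using dim_poly_act[OF X v] by simp
    have "Y *\<^sub>v poly_act (pCons a h) X v = a \<cdot>\<^sub>v (Y *\<^sub>v v) + Y *\<^sub>v (X *\<^sub>v ?x)"
      unfolding poly_act_pCons[OF X v] using x
      by (simp add: mult_add_distrib_mat_vec[of _ n n] mult_mat_vec[of _ n n])
    then have "(Y *\<^sub>v poly_act (pCons a h) X v) $ i = (Y *\<^sub>v (X *\<^sub>v ?x)) $ i"
      unfolding Yv using i by simp
    also have "\<dots> = (X *\<^sub>v poly_act h' X v) $ i - ?x $ i - (w \<bullet> ?x) * v $ i"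
      unfolding c using i carrier_vecD[OF x] by (simp add: dim_poly_act[OF X v])
    also have "\<dots> = poly_act h'' X v $ i"
      unfolding h''_def poly_act_diff[OF X v] poly_act_const[OF X v] poly_act_pCons[OF X v, of 0]
      using i by (simp add: dim_poly_act[OF X v])
    finally show "(Y *\<^sub>v poly_act (pCons a h) X v) $ i = poly_act h'' X v $ i" .
  qed (simp add: dim_poly_act[OF X v])
  have "coeff h'' i = (of_nat n - of_nat (Suc i)) * coeff (pCons a h) (Suc i)"
    if d: "degree (pCons a h) \<le> Suc i" for i
  proof (cases i)
    case 0
    \<comment> \<open>Only here does the rank-one term reach the top coefficient: it contributes
      \<open>- (w \<bullet> v) = n\<close> times \<open>b\<close>, and together with
      \<open>- b\<close> this starts the sequence at \<open>n - 1\<close>.\<close>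
    then have "degree h = 0"
      using d by (cases "h = 0") auto
    then obtain b where b: "h = [:b:]"
      by (rule degree_eq_zeroE)
    show ?thesis
      using 0 by (simp add: h''_def b poly_act_const[OF X v] trace_identity algebra_simps)
  next
    case (Suc j)
    then have "degree h \<le> Suc j"
      using d by (cases "h = 0") auto
    from h'(2)[OF this] show ?thesis
      using Suc by (simp add: h''_def algebra_simps)
  qed
  with eq show ?case
    by blast
qed

text \<open>After \<open>k\<close> lowerings only the coefficient of degree \<open>k\<close>
  survives, multiplied by \<open>n - 1\<close>, \<open>n - 2\<close>, ..., \<open>n - k\<close>.
  These factors are nonzero for \<open>k < n\<close>.\<close>

lemma lowering_power:
  assumes Yv: "Y *\<^sub>v v = 0\<^sub>v n" and "degree h \<le> k"
  shows "Y ^\<^sub>m k *\<^sub>v poly_act h X v = ((\<Prod>i<k. of_nat n - of_nat (Suc i)) * coeff h k) \<cdot>\<^sub>v v"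
  using assms(2)
proof (induction k arbitrary: h)
  case 0
  then obtain b where "h = [:b:]"
    by (auto elim: degree_eq_zeroE)
  then show ?case
    by (simp add: pow_mat_0_vec[OF Y, simplified] poly_act_const[OF X v])
next
  case (Suc k)
  obtain h' where h': "Y *\<^sub>v poly_act h X v = poly_act h' X v"
    "\<And>i. degree h \<le> Suc i \<Longrightarrow> coeff h' i = (of_nat n - of_nat (Suc i)) * coeff h (Suc i)"
    using lowering[OF Yv] by blast
  have "degree h' \<le> k"
    using Suc.prems by (intro degree_le) (auto simp: h'(2) coeff_eq_0)
  from Suc.IH[OF this] show ?case
    unfolding pow_mat_Suc_vec'[OF Y poly_act_carrier[OF X v]] h'(1)
    using h'(2)[OF Suc.prems] by (simp add: mult_ac)
qed

lemma lowering_power_eq_0: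
  assumes Yv: "Y *\<^sub>v v = 0\<^sub>v n" and h: "\<forall>i\<ge>k. coeff h i = 0"
  shows "Y ^\<^sub>m k *\<^sub>v poly_act h X v = 0\<^sub>v n"
proof -
  have "degree h \<le> k"
    using h by (intro degree_le) auto
  from lowering_power[OF Yv this] show ?thesis
    using h by (auto intro!: eq_vecI)
qed

lemma nilpotent:
  assumes Yv: "Y *\<^sub>v v = 0\<^sub>v n" and "krylov_indep n X v" and "x \<in> carrier_vec n"
  shows "Y ^\<^sub>m n *\<^sub>v x = 0\<^sub>v n"
  using krylov_indep_spans[OF X v assms(2,3)] lowering_power_eq_0[OF Yv] by blast

text \<open>A relation \<open>p(Y\<^sup>T) w = 0\<close> is tested on \<open>X^j v\<close>, with
  \<open>j\<close> the lowest index of a nonzero coefficient of \<open>p\<close>: smaller powers of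
  \<open>Y\<close> have coefficient zero, larger ones kill \<open>X^j v\<close>.\<close>

lemma cyclic_transpose:
  assumes Yv: "Y *\<^sub>v v = 0\<^sub>v n" and "krylov_indep n X v"
  shows "krylov_indep n (Y\<^sup>T) w"
  unfolding krylov_indep_def
proof (intro allI impI)
  fix p
  assume p: "\<forall>i\<ge>n. coeff p i = 0" and "poly_act p (Y\<^sup>T) w = 0\<^sub>v (dim_vec w)"
  then have 0: "poly_act p (Y\<^sup>T) w = 0\<^sub>v n"
    by simp
  show "p = 0"
  proof (rule ccontr)
    assume "p \<noteq> 0"
    define j where "j = (LEAST j. coeff p j \<noteq> 0)"
    have ex: "\<exists>j. coeff p j \<noteq> 0"
      using \<open>p \<noteq> 0\<close> by (auto simp: poly_eq_iff)
    then have j: "coeff p j \<noteq> 0" "\<And>i. i < j \<Longrightarrow> coeff p i = 0"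
      unfolding j_def using LeastI_ex[OF ex] not_less_Least by blast+
    then have "j < n"
      using p by (meson not_le)
    define x where "x = poly_act (monom 1 j) X v"
    have x: "x \<in> carrier_vec n"
      unfolding x_def by (rule poly_act_carrier[OF X v])
    have "0 = w \<bullet> poly_act p Y x"
      using poly_act_transpose[OF Y x w, of p] 0 x by simp
    also have "\<dots> = (\<Sum>m<n. coeff p m * (w \<bullet> (Y ^\<^sub>m m *\<^sub>v x)))"
      by (rule scalar_prod_poly_act[OF Y x w p])
    also have "\<dots> = (\<Sum>m\<in>{j}. coeff p m * (w \<bullet> (Y ^\<^sub>m m *\<^sub>v x)))"
    proof (rule sum.mono_neutral_right)
      show "\<forall>m\<in>{..<n} - {j}. coeff p m * (w \<bullet> (Y ^\<^sub>m m *\<^sub>v x)) = 0"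
      proof
        fix m assume "m \<in> {..<n} - {j}"
        then consider "m < j" | "j < m"
          by force
        then show "coeff p m * (w \<bullet> (Y ^\<^sub>m m *\<^sub>v x)) = 0"
        proof cases
          case 2
          then have "Y ^\<^sub>m m *\<^sub>v x = 0\<^sub>v n"
            unfolding x_def by (intro lowering_power_eq_0[OF Yv]) auto
          then show ?thesis
            by simp
        qed (simp add: j(2))
      qed
    qed (use \<open>j < n\<close> in auto)
    also have "\<dots> = coeff p j * ((\<Prod>i<j. of_nat n - of_nat (Suc i)) * (- of_nat n))"
      using lowering_power[OF Yv, of "monom 1 j" j] by (simp add: x_def degree_monom_le trace_identity)
    \<comment> \<open>Both \<open>coeff p j\<close> and \<open>n\<close> are nonzero, so the product
      of lowering factors would have to vanish, which \<open>j < n\<close> excludes.\<close>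
    finally have "(\<Prod>i<j. of_nat n - of_nat (Suc i)) = (0 :: complex)"
      using j(1) \<open>j < n\<close> by auto
    then obtain i where "i < j" "of_nat n = (of_nat (Suc i) :: complex)"
      by auto
    then show False
      using \<open>j < n\<close> of_nat_eq_iff[of n "Suc i", where ?'a = complex] by simp
  qed
qed

lemma conj_canonical:
  assumes Yv: "Y *\<^sub>v v = 0\<^sub>v n" and Xw: "X\<^sup>T *\<^sub>v w = 0\<^sub>v n"
    and cyc: "krylov_indep n (Y\<^sup>T) w" and nil: "\<And>x. x \<in> carrier_vec n \<Longrightarrow> Y ^\<^sub>m n *\<^sub>v x = 0\<^sub>v n"
  shows "conj_pair n (X, Y) (canonical_X n, canonical_Y n)"
proof -
  have XT: "X\<^sup>T \<in> carrier_mat n n" and YT: "Y\<^sup>T \<in> carrier_mat n n"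
    by simp_all
  \<comment> \<open>The row vectors \<open>w Y^k\<close>, written as columns; they become the new
    basis.\<close>
  define r where "r k = (Y\<^sup>T) ^\<^sub>m k *\<^sub>v w" for k
  have r: "r k \<in> carrier_vec n" for k
    unfolding r_def by (rule pow_mat_vec_carrier[OF YT w])
  have r0: "r 0 = w" and rSuc: "r (Suc k) = Y\<^sup>T *\<^sub>v r k" for k
    unfolding r_def by (rule pow_mat_0_vec[OF YT w], rule pow_mat_Suc_vec[OF YT w])
  have r_scalar: "r k \<bullet> x = w \<bullet> (Y ^\<^sub>m k *\<^sub>v x)" if x: "x \<in> carrier_vec n" for k x
    using poly_act_transpose[OF Y x w, of "monom 1 k"] x r[of k]
    by (simp add: poly_act_monom[OF Y x] poly_act_monom[OF YT w] r_def[symmetric])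
  have rn: "r n = 0\<^sub>v n"
    using r nil by (intro vec_eq_if_scalar_prod_eq[of _ n])
      (auto simp: comm_scalar_prod[of _ n "r n"] r_scalar)
  \<comment> \<open>Since \<open>Y v = 0\<close>, the rank-one term acts only on \<open>r 0\<close>,
    where the trace identity supplies its value.\<close>
  have v_r: "v \<bullet> r k = (if k = 0 then - of_nat n else 0)" for k
  proof -
    have "v \<bullet> r k = w \<bullet> (Y ^\<^sub>m k *\<^sub>v v)"
      using comm_scalar_prod[OF v r] r_scalar[OF v] by simp
    also have "\<dots> = (if k = 0 then - of_nat n else 0)"
    proof (cases k)
      case 0
      then show ?thesis
        using pow_mat_0_vec[OF Y v] trace_identity by simp
    next
      case (Suc l)
      have "Y ^\<^sub>m l *\<^sub>v 0\<^sub>v n = 0\<^sub>v n"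
        by (intro eq_vecI) (auto simp: scalar_prod_def)
      then show ?thesis
        unfolding Suc pow_mat_Suc_vec'[OF Y v] Yv by simp
    qed
    finally show ?thesis .
  qed
  \<comment> \<open>Each use of \<open>comm_transpose\<close> moves \<open>X\<^sup>T\<close> past
    one \<open>Y\<^sup>T\<close> and subtracts \<open>r k\<close>; the start
    \<open>X\<^sup>T *\<^sub>v w = 0\<close> and the value of \<open>v_r\<close> at \<open>0\<close>
    give \<open>n - 1\<close> first.\<close>
  have Xr: "X\<^sup>T *\<^sub>v r (Suc k) = (of_nat n - of_nat (Suc k)) \<cdot>\<^sub>v r k" for k
  proof (induction k)
    case 0
    have "Y\<^sup>T *\<^sub>v 0\<^sub>v n = 0\<^sub>v n"
      by (intro eq_vecI) (auto simp: scalar_prod_def)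
    then show ?case
      unfolding rSuc comm_transpose[OF r] v_r unfolding r0 Xw
      by (intro eq_vecI) (auto simp: algebra_simps)
  next
    case (Suc k)
    have "Y\<^sup>T *\<^sub>v ((of_nat n - of_nat (Suc k)) \<cdot>\<^sub>v r k) = (of_nat n - of_nat (Suc k)) \<cdot>\<^sub>v r (Suc k)"
      unfolding rSuc by (rule mult_mat_vec[OF YT r])
    then show ?case
      unfolding rSuc[of "Suc k"] comm_transpose[OF r] v_r Suc
      using carrier_vecD[OF r[of "Suc k"]] by (intro eq_vecI) (auto simp: algebra_simps)
  qed
  \<comment> \<open>\<open>R\<close> has the rows \<open>r 0\<close>, ..., \<open>r (n - 1)\<close>,
    so the rows of \<open>R * X\<close> and \<open>R * Y\<close> are the images of the
    \<open>r k\<close> under \<open>X\<^sup>T\<close> and \<open>Y\<^sup>T\<close>.\<close>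
  define R where "R = (krylov_mat n n (Y\<^sup>T) w)\<^sup>T"
  have R: "R \<in> carrier_mat n n"
    by (simp add: R_def)
  have R_entry: "R $$ (k, j) = r k $ j" if "k < n" "j < n" for k j
    using that by (simp add: R_def krylov_mat_def r_def)
  have R_mult: "(R * A) $$ (k, j) = (A\<^sup>T *\<^sub>v r k) $ j" if "k < n" "j < n" "A \<in> carrier_mat n n" for k j A
    using that R r[of k] by (simp add: scalar_prod_def R_entry mult.commute)
  have mult_R: "(A * R) $$ (k, j) = (\<Sum>l<n. A $$ (k, l) * r l $ j)"
    if "k < n" "j < n" "A \<in> carrier_mat n n" for k j A
    using that R by (simp add: scalar_prod_def R_entry atLeast0LessThan)
  obtain B where B: "B \<in> carrier_mat n n" "krylov_mat n n (Y\<^sup>T) w * B = 1\<^sub>m n"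
      "B * krylov_mat n n (Y\<^sup>T) w = 1\<^sub>m n"
    using krylov_mat_inverse[OF YT w cyc] by blast
  define Q where "Q = B\<^sup>T"
  have Q: "Q \<in> carrier_mat n n"
    using B by (simp add: Q_def)
  have K: "krylov_mat n n (Y\<^sup>T) w \<in> carrier_mat n n"
    by simp
  have RQ: "R * Q = 1\<^sub>m n" and QR: "Q * R = 1\<^sub>m n"
    unfolding R_def Q_def transpose_mult[OF B(1) K, symmetric] transpose_mult[OF K B(1), symmetric] B(2,3)
    by simp_all
  have cX: "canonical_X n \<in> carrier_mat n n" and cY: "canonical_Y n \<in> carrier_mat n n"
    by (simp_all add: canonical_X_def canonical_Y_def)
  have "R * X = canonical_X n * R"
  proof (rule eq_matI)
    fix k j assume "k < dim_row (canonical_X n * R)" "j < dim_col (canonical_X n * R)"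
    then have kj: "k < n" "j < n"
      using R cX by auto
    show "(R * X) $$ (k, j) = (canonical_X n * R) $$ (k, j)"
    proof (cases k)
      case 0
      then show ?thesis
        unfolding R_mult[OF kj X] mult_R[OF kj cX] using kj Xw by (simp add: canonical_X_def r0)
    next
      case (Suc m)
      have "(\<Sum>l<n. canonical_X n $$ (k, l) * r l $ j)
          = (\<Sum>l<n. (if l = m then (of_nat n - of_nat k) else 0) * r l $ j)"
        using kj Suc by (intro sum.cong) (auto simp: canonical_X_def)
      also have "\<dots> = (of_nat n - of_nat k) * r m $ j"
        using kj Suc by (simp add: if_distrib[of "\<lambda>u. u * _"] cong: if_cong)
      finally show ?thesis
        unfolding R_mult[OF kj X] mult_R[OF kj cX] using kj carrier_vecD[OF r[of m]] Suc by (simp add: Xr)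
    qed
  qed (use R cX in auto)
  then have X': "R * X * Q = canonical_X n"
    using assoc_mult_mat[OF cX R Q] RQ cX by simp
  have "R * Y = canonical_Y n * R"
  proof (rule eq_matI)
    fix k j assume "k < dim_row (canonical_Y n * R)" "j < dim_col (canonical_Y n * R)"
    then have kj: "k < n" "j < n"
      using R cY by auto
    have "(\<Sum>l<n. canonical_Y n $$ (k, l) * r l $ j) = (\<Sum>l<n. (if l = Suc k then 1 else 0) * r l $ j)"
      using kj by (intro sum.cong) (auto simp: canonical_Y_def)
    also have "\<dots> = (if Suc k < n then r (Suc k) $ j else 0)"
      by (simp add: if_distrib[of "\<lambda>u. u * _"] cong: if_cong)
    \<comment> \<open>In the last row the shift produces zero, which agrees with
      \<open>r n = 0\<close>.\<close>
    also have "\<dots> = r (Suc k) $ j"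
    proof (cases "Suc k < n")
      case False
      then have "Suc k = n"
        using kj by simp
      then show ?thesis
        using rn kj by simp
    qed simp
    finally show "(R * Y) $$ (k, j) = (canonical_Y n * R) $$ (k, j)"
      unfolding R_mult[OF kj Y] mult_R[OF kj cY] rSuc by simp
  qed (use R cY in auto)
  then have Y': "R * Y * Q = canonical_Y n"
    using assoc_mult_mat[OF cY R Q] RQ cY by simp
  show ?thesis
    unfolding conj_pair_def using R Q RQ QR X' Y' by (intro exI[of _ R] exI[of _ Q]) simp
qed

end

subsection \<open>Transitivity\<close>

text \<open>The generators involve derivatives \<open>p'\<close>; in characteristic zero every
  polynomial is one, so arbitrary polynomials in \<open>Y\<close> or \<open>X\<close> can be
  added.\<close>

lemma ex_antiderivative: "\<exists>q. pderiv q = (p :: complex poly)"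
proof
  let ?q = "\<Sum>i\<le>degree p. monom (coeff p i / of_nat (Suc i)) (Suc i)"
  have q: "coeff ?q (Suc k) = coeff p k / of_nat (Suc k)" for k
    by (simp add: coeff_sum coeff_eq_0 del: of_nat_Suc)
  show "pderiv ?q = p"
    by (rule poly_eqI) (simp add: coeff_pderiv q del: of_nat_Suc)
qed

text \<open>Take a nonzero column as \<open>v\<close>. A column that is not a multiple of it would
  give two independent columns and hence rank at least two.\<close>

lemma rank_le_1_outer_product:
  fixes M :: "complex mat"
  assumes M: "M \<in> carrier_mat n n" and rank: "vec_space.rank n M \<le> 1"
  shows "\<exists>v\<in>carrier_vec n. \<exists>w\<in>carrier_vec n. \<forall>i<n. \<forall>j<n. M $$ (i, j) = v $ i * w $ j"
proof (cases "\<forall>j<n. col M j = 0\<^sub>v n")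
  case True
  have "M $$ (i, j) = 0" if "i < n" "j < n" for i j
  proof -
    have "col M j $ i = 0"
      using True that by simp
    then show ?thesis
      using that M by simp
  qed
  then show ?thesis
    by (intro bexI[of _ "0\<^sub>v n"]) auto
next
  case False
  then obtain j0 where j0: "j0 < n" "col M j0 \<noteq> 0\<^sub>v n"
    by blast
  define v where "v = col M j0"
  have v: "v \<in> carrier_vec n" "v \<noteq> 0\<^sub>v n"
    using j0 M by (auto simp: v_def)
  interpret vec_space "TYPE(complex)" n .
  have "\<exists>c. col M j = c \<cdot>\<^sub>v v" if j: "j < n" for j
  proof (rule ccontr)
    assume no: "\<nexists>c. col M j = c \<cdot>\<^sub>v v"
    define u where "u = col M j"
    have u: "u \<in> carrier_vec n"
      using j M by (simp add: u_def)
    have "u \<noteq> v"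
      using no one_smult_vec[of v] by (metis u_def)
    \<comment> \<open>The two-column matrix turns linear dependence of \<open>v\<close> and
      \<open>u\<close> into a kernel vector with two explicit entries.\<close>
    define N where "N = mat_of_cols n [v, u]"
    have N: "N \<in> carrier_mat n 2"
      by (simp add: N_def mat_of_cols_def numeral_2_eq_2)
    have cols: "cols N = [v, u]"
      unfolding N_def using u v by (intro cols_mat_of_cols) auto
    have "lin_indpt {v, u}"
    proof
      assume "lin_dep {v, u}"
      then obtain c where c: "c \<in> carrier_vec 2" "c \<noteq> 0\<^sub>v 2" "N *\<^sub>v c = 0\<^sub>v n"
        using lin_depE[OF N] \<open>u \<noteq> v\<close> by (auto simp: cols)
      have eq: "v $ i * c $ 0 + u $ i * c $ 1 = 0" if "i < n" for i
        using arg_cong[OF c(3), of "\<lambda>z. z $ i"] that c(1) N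
        by (simp add: N_def mat_of_cols_def scalar_prod_def numeral_2_eq_2)
      show False
      proof (cases "c $ 1 = 0")
        case True
        have "c $ 0 \<noteq> 0"
        proof
          assume "c $ 0 = 0"
          with True c(1) have "c = 0\<^sub>v 2"
            by (intro eq_vecI) (auto simp: less_2_cases_iff)
          with c(2) show False ..
        qed
        then have "v = 0\<^sub>v n"
          using eq True v by (intro eq_vecI) auto
        with v(2) show False ..
      next
        case False
        have "u = (- c $ 0 / c $ 1) \<cdot>\<^sub>v v"
        proof (rule eq_vecI)
          fix i assume "i < dim_vec ((- c $ 0 / c $ 1) \<cdot>\<^sub>v v)"
          then have "i < n"
            using v by simp
          have "u $ i * c $ 1 = - (v $ i * c $ 0)"
            using eq[OF \<open>i < n\<close>] by (simp only: eq_neg_iff_add_eq_0 add.commute)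
          then have "u $ i = - (v $ i * c $ 0) / c $ 1"
            using False by (simp only: nonzero_eq_divide_eq not_False_eq_True)
          then show "u $ i = ((- c $ 0 / c $ 1) \<cdot>\<^sub>v v) $ i"
            using \<open>i < n\<close> v by (simp add: mult.commute)
        qed (use u v in simp)
        with no show False
          unfolding u_def by blast
      qed
    qed
    moreover have "{v, u} \<subseteq> set (cols M)"
      using j j0(1) M by (auto simp: u_def v_def cols_def)
    ultimately have "card {v, u} \<le> rank M"
      by (intro rank_ge_card_indpt[OF M])
    with rank \<open>u \<noteq> v\<close> show False
      by simp
  qed
  then obtain c where c: "\<And>j. j < n \<Longrightarrow> col M j = c j \<cdot>\<^sub>v v"
    by metis
  have "M $$ (i, j) = v $ i * vec n c $ j" if "i < n" "j < n" for i j
    using arg_cong[OF c[OF that(2)], of "\<lambda>u. u $ i"] that M v by simp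
  then show ?thesis
    using v(1) by (intro bexI[of _ v] bexI[of _ "vec n c"]) auto
qed

lemma CM_pairs_calogero_moser:
  assumes "(X, Y) \<in> CM_pairs n"
  shows "\<exists>v w. calogero_moser n X Y v w"
proof -
  have X: "X \<in> carrier_mat n n" and Y: "Y \<in> carrier_mat n n"
    and rank: "vec_space.rank n (X * Y - Y * X - 1\<^sub>m n) \<le> 1"
    using assms by (auto simp: CM_pairs_def)
  have XY: "X * Y \<in> carrier_mat n n" and YX: "Y * X \<in> carrier_mat n n"
    using X Y by auto
  obtain v w where v: "v \<in> carrier_vec n" and w: "w \<in> carrier_vec n"
    and M: "\<And>i j. i < n \<Longrightarrow> j < n \<Longrightarrow> (X * Y - Y * X - 1\<^sub>m n) $$ (i, j) = v $ i * w $ j"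
    using rank_le_1_outer_product[OF _ rank] X Y by (metis minus_carrier_mat one_carrier_mat)
  have "calogero_moser n X Y v w"
  proof
    fix x :: "complex vec"
    assume x: "x \<in> carrier_vec n"
    have "(X * Y) *\<^sub>v x = (Y * X) *\<^sub>v x + x + (w \<bullet> x) \<cdot>\<^sub>v v"
    proof (rule eq_vecI)
      fix i assume "i < dim_vec ((Y * X) *\<^sub>v x + x + (w \<bullet> x) \<cdot>\<^sub>v v)"
      then have i: "i < n"
        using v by simp
      have entry: "(X * Y) $$ (i, j) = (Y * X) $$ (i, j) + (if j = i then 1 else 0) + v $ i * w $ j"
        if "j < n" for j
        using M[OF i that] i that carrier_matD[OF X] carrier_matD[OF Y]
        by (auto simp: algebra_simps simp del: index_mult_mat(1))
      have mult_vec: "(Z *\<^sub>v x) $ i = (\<Sum>j<n. Z $$ (i, j) * x $ j)" if "Z \<in> carrier_mat n n" for Z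
        using i that x by (simp add: scalar_prod_def atLeast0LessThan)
      have "((X * Y) *\<^sub>v x) $ i = (\<Sum>j<n. (X * Y) $$ (i, j) * x $ j)"
        by (rule mult_vec[OF XY])
      also have "\<dots> = (\<Sum>j<n. (Y * X) $$ (i, j) * x $ j) + x $ i + (w \<bullet> x) * v $ i"
        using i x by (simp add: entry sum.distrib algebra_simps scalar_prod_def atLeast0LessThan
            sum_distrib_left if_distrib[of "\<lambda>u. _ * u"] cong: if_cong del: index_mult_mat(1))
      also have "(\<Sum>j<n. (Y * X) $$ (i, j) * x $ j) = ((Y * X) *\<^sub>v x) $ i"
        by (rule mult_vec[OF YX, symmetric])
      finally show "((X * Y) *\<^sub>v x) $ i = ((Y * X) *\<^sub>v x + x + (w \<bullet> x) \<cdot>\<^sub>v v) $ i"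
        using i x v YX by (simp del: assoc_mult_mat_vec)
    qed (use X Y v in auto)
    then show "X *\<^sub>v (Y *\<^sub>v x) = Y *\<^sub>v (X *\<^sub>v x) + x + (w \<bullet> x) \<cdot>\<^sub>v v"
      using assoc_mult_mat_vec[OF X Y x] assoc_mult_mat_vec[OF Y X x] by simp
  qed (use X Y v w in auto)
  then show ?thesis
    by blast
qed

lemma gen_step_add: "gen_step n (X, Y) (X + mat_poly_eval n p Y, Y)"
  using ex_antiderivative[of p] by (auto simp: gen_step_def Phi_def)

lemma gen_step_diff: "gen_step n (X, Y) (X, Y - mat_poly_eval n p X)"
  using ex_antiderivative[of p] by (auto simp: gen_step_def Psi_def)

lemma (in calogero_moser) reaches_canonical:
  "\<exists>C. (gen_step n)\<^sup>*\<^sup>* (X, Y) C \<and> conj_pair n C (canonical_X n, canonical_Y n)"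
proof -
  obtain p where p: "krylov_indep n (X + mat_poly_eval n p Y) v"
    using ex_cyclic by blast
  define X1 where "X1 = X + mat_poly_eval n p Y"
  interpret C1: calogero_moser n X1 Y v w
    unfolding X1_def by (rule add_poly)
  have cyc: "krylov_indep n X1 v"
    using p by (simp add: X1_def)
  \<comment> \<open>Cyclicity of \<open>v\<close> expresses \<open>Y v\<close> as
    \<open>q(X1) v\<close>; subtracting \<open>q(X1)\<close> from \<open>Y\<close> then kills
    \<open>v\<close>.\<close>
  obtain q where q: "poly_act q X1 v = Y *\<^sub>v v"
    using krylov_indep_spans[OF C1.X v cyc, of "Y *\<^sub>v v"] by auto
  define Y1 where "Y1 = Y - mat_poly_eval n q X1"
  interpret C2: calogero_moser n X1 Y1 v w
    unfolding Y1_def by (rule C1.diff_poly)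
  have Y1v: "Y1 *\<^sub>v v = 0\<^sub>v n"
    unfolding Y1_def minus_mult_distrib_mat_vec[OF Y mat_poly_eval_carrier[OF C1.X] v]
      mat_poly_eval_vec[OF v] q by simp
  have cyc': "krylov_indep n (Y1\<^sup>T) w"
    by (rule C2.cyclic_transpose[OF Y1v cyc])
  have Y1T: "Y1\<^sup>T \<in> carrier_mat n n" and X1w: "X1\<^sup>T *\<^sub>v w \<in> carrier_vec n"
    by (auto intro!: carrier_vecI)
  \<comment> \<open>The dual choice: in terms of rows, \<open>w a(Y1) = w X1\<close>, so subtracting
    \<open>a(Y1)\<close> from \<open>X1\<close> makes \<open>w X2 = 0\<close>.\<close>
  obtain a where a: "poly_act a (Y1\<^sup>T) w = X1\<^sup>T *\<^sub>v w"
    using krylov_indep_spans[OF Y1T w cyc' X1w] by blast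
  define X2 where "X2 = X1 + mat_poly_eval n (- a) Y1"
  interpret C3: calogero_moser n X2 Y1 v w
    unfolding X2_def by (rule C2.add_poly)
  have X2w: "X2\<^sup>T *\<^sub>v w = 0\<^sub>v n"
  proof (rule vec_eq_if_scalar_prod_eq[of _ n])
    fix z :: "complex vec"
    assume z: "z \<in> carrier_vec n"
    have "z \<bullet> (X2\<^sup>T *\<^sub>v w) = (X2\<^sup>T *\<^sub>v w) \<bullet> z"
      using z by (intro comm_scalar_prod[of _ n]) (auto intro!: carrier_vecI)
    also have "\<dots> = w \<bullet> (X2 *\<^sub>v z)"
      by (rule transpose_vec_mult_scalar[OF C3.X z w])
    also have "X2 *\<^sub>v z = X1 *\<^sub>v z + poly_act (- a) Y1 z"
      unfolding X2_def add_mult_distrib_mat_vec[OF C1.X mat_poly_eval_carrier[OF C2.Y] z]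
        mat_poly_eval_vec[OF z] ..
    also have "w \<bullet> \<dots> = w \<bullet> (X1 *\<^sub>v z) - w \<bullet> poly_act a Y1 z"
      unfolding poly_act_uminus[OF C2.Y z] using z poly_act_carrier[OF C2.Y z, of a]
      by (simp add: scalar_prod_add_distrib[of _ n] dim_poly_act[OF C2.Y z])
    also have "w \<bullet> poly_act a Y1 z = (X1\<^sup>T *\<^sub>v w) \<bullet> z"
      using poly_act_transpose[OF C2.Y z w, of a] by (simp add: a)
    also have "\<dots> = w \<bullet> (X1 *\<^sub>v z)"
      by (rule transpose_vec_mult_scalar[OF C1.X z w])
    finally show "z \<bullet> (X2\<^sup>T *\<^sub>v w) = z \<bullet> 0\<^sub>v n"
      using z by simp
  qed (auto intro!: carrier_vecI)
  \<comment> \<open>Cyclicity of \<open>w\<close> and nilpotency were derived from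
    \<open>X1\<close>, but they concern \<open>Y1\<close> alone and so survive the change to
    \<open>X2\<close>.\<close>
  have "conj_pair n (X2, Y1) (canonical_X n, canonical_Y n)"
    using Y1v X2w cyc' C2.nilpotent[OF Y1v cyc] by (rule C3.conj_canonical)
  moreover have s: "gen_step n (X, Y) (X1, Y)" "gen_step n (X1, Y) (X1, Y1)" "gen_step n (X1, Y1) (X2, Y1)"
    unfolding X1_def Y1_def X2_def by (rule gen_step_add gen_step_diff)+
  have "(gen_step n)\<^sup>*\<^sup>* (X, Y) (X2, Y1)"
    by (rule rtranclp_trans[OF rtranclp_trans[OF s(1,2)[THEN r_into_rtranclp[where r = "gen_step n"]]] s(3)[THEN r_into_rtranclp[where r = "gen_step n"]]])
  ultimately show ?thesis
    by blast
qed

section \<open>Invertibility of the generators and compatibility with conjugation\<close>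

definition mat_pairs :: "nat \<Rightarrow> (complex mat \<times> complex mat) set" where
  "mat_pairs n = carrier_mat n n \<times> carrier_mat n n"

lemma mat_poly_eval_uminus:
  assumes A: "A \<in> carrier_mat n n"
  shows "mat_poly_eval n (- p) A = - mat_poly_eval n p A"
proof -
  have "degree (- p) = degree p"
    by simp
  then show ?thesis
    using index_mat_poly_eval[OF A] carrier_matD[OF index_mat_poly_eval(1)[OF A]]
    by (intro eq_matI) (simp_all add: sum_negf)
qed

lemma gen_step_mat_pairs:
  assumes "gen_step n A B" "A \<in> mat_pairs n"
  shows "B \<in> mat_pairs n"
  using assms by (auto simp: gen_step_def Phi_def Psi_def mat_pairs_def intro!: minus_carrier_mat)

text \<open>A generator fixes the matrix at which its polynomial is evaluated, so the generator of
  \<open>- p\<close> undoes it.\<close>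

lemma gen_step_sym:
  assumes AB: "gen_step n A B" and A: "A \<in> mat_pairs n"
  shows "gen_step n B A"
proof -
  obtain X Y where XY: "A = (X, Y)" and X: "X \<in> carrier_mat n n" and Y: "Y \<in> carrier_mat n n"
    using A by (auto simp: mat_pairs_def)
  obtain p where "B = Phi n p A \<or> B = Psi n p A"
    using AB by (auto simp: gen_step_def)
  then show ?thesis
  proof
    assume B: "B = Phi n p A"
    let ?E = "mat_poly_eval n (pderiv p) Y"
    have E: "?E \<in> carrier_mat n n"
      by (rule mat_poly_eval_carrier[OF Y])
    have "Phi n (- p) B = A"
      using X E by (auto simp: B XY Phi_def pderiv_minus mat_poly_eval_uminus[OF Y] intro!: eq_matI)
    then show ?thesis
      by (auto simp: gen_step_def)
  next
    assume B: "B = Psi n p A"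
    let ?E = "mat_poly_eval n (pderiv p) X"
    have E: "?E \<in> carrier_mat n n"
      by (rule mat_poly_eval_carrier[OF X])
    have "Psi n (- p) B = A"
      using Y E by (auto simp: B XY Psi_def pderiv_minus mat_poly_eval_uminus[OF X] intro!: eq_matI)
    then show ?thesis
      by (auto simp: gen_step_def)
  qed
qed

lemma gen_steps_sym:
  assumes "(gen_step n)\<^sup>*\<^sup>* A B" "A \<in> mat_pairs n"
  shows "(gen_step n)\<^sup>*\<^sup>* B A \<and> B \<in> mat_pairs n"
  using assms
proof (induction rule: rtranclp_induct)
  case (step B C)
  then show ?case
    using gen_step_sym[of n B C] gen_step_mat_pairs[of n B C] converse_rtranclp_into_rtranclp[of "gen_step n" C B A]
    by blast
qed auto

text \<open>Conjugation is a ring homomorphism on matrices: the inner \<open>Q * P\<close> cancels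
  in every product.\<close>

lemma mat_poly_eval_conj:
  assumes A: "A \<in> carrier_mat n n" and P: "P \<in> carrier_mat n n" and Q: "Q \<in> carrier_mat n n"
    and PQ: "P * Q = 1\<^sub>m n" and QP: "Q * P = 1\<^sub>m n"
  shows "mat_poly_eval n p (P * A * Q) = P * mat_poly_eval n p A * Q"
proof -
  have PAQ: "P * A * Q \<in> carrier_mat n n"
    using A P Q by auto
  show ?thesis
  proof (induction p)
    case 0
    then show ?case
      using P Q by (simp add: mat_poly_eval_0[OF A] mat_poly_eval_0[OF PAQ])
  next
    case (pCons a p)
    let ?E = "mat_poly_eval n p A"
    have E: "?E \<in> carrier_mat n n"
      by (rule mat_poly_eval_carrier[OF A])
    have AE: "A * ?E \<in> carrier_mat n n" and EQ: "?E * Q \<in> carrier_mat n n"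
      using mult_carrier_mat[OF A E] mult_carrier_mat[OF E Q] .
    have "P * A * Q * (P * ?E * Q) = P * (A * ((Q * P) * (?E * Q)))"
      using A P Q E EQ by (simp add: assoc_mult_mat[of _ n n _ n _ n])
    also have "\<dots> = P * (A * ?E) * Q"
      unfolding QP left_mult_one_mat[OF EQ] using A P Q E EQ by (simp add: assoc_mult_mat[of _ n n _ n _ n])
    finally have E': "P * A * Q * (P * ?E * Q) = P * (A * ?E) * Q" .
    have "a \<cdot>\<^sub>m 1\<^sub>m n = P * (a \<cdot>\<^sub>m 1\<^sub>m n) * Q"
      unfolding mult_smult_distrib[OF P one_carrier_mat] right_mult_one_mat[OF P]
        mult_smult_assoc_mat[OF P Q] PQ ..
    then have "a \<cdot>\<^sub>m 1\<^sub>m n + P * A * Q * (P * ?E * Q) = P * (a \<cdot>\<^sub>m 1\<^sub>m n) * Q + P * (A * ?E) * Q"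
      unfolding E' by (rule arg_cong)
    also have "\<dots> = P * (a \<cdot>\<^sub>m 1\<^sub>m n + A * ?E) * Q"
      using P Q AE by (simp add: mult_add_distrib_mat[of _ n n _ n] add_mult_distrib_mat[of _ n n _ _ n])
    finally show ?case
      unfolding mat_poly_eval_pCons[OF A] mat_poly_eval_pCons[OF PAQ] pCons.IH .
  qed
qed

text \<open>The generators are equivariant under simultaneous conjugation, so a step taken from
  \<open>A\<close> can be copied at any conjugate \<open>B\<close> with the same polynomial.\<close>

lemma gen_step_conj:
  assumes AB: "conj_pair n A B" and A: "A \<in> mat_pairs n" and step: "gen_step n A A'"
  shows "\<exists>B'. gen_step n B B' \<and> conj_pair n A' B'"
proof -
  obtain X Y where XY: "A = (X, Y)" and X: "X \<in> carrier_mat n n" and Y: "Y \<in> carrier_mat n n"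
    using A by (auto simp: mat_pairs_def)
  obtain P Q where P: "P \<in> carrier_mat n n" and Q: "Q \<in> carrier_mat n n"
    and PQ: "P * Q = 1\<^sub>m n" and QP: "Q * P = 1\<^sub>m n"
    and B: "B = (P * X * Q, P * Y * Q)"
    using AB by (cases B) (auto simp: conj_pair_def XY)
  obtain p where "A' = Phi n p A \<or> A' = Psi n p A"
    using step by (auto simp: gen_step_def)
  then show ?thesis
  proof
    assume A': "A' = Phi n p A"
    let ?E = "mat_poly_eval n (pderiv p) Y"
    have E: "?E \<in> carrier_mat n n"
      by (rule mat_poly_eval_carrier[OF Y])
    have "P * (X + ?E) * Q = P * X * Q + P * ?E * Q"
      using P Q X E by (simp add: mult_add_distrib_mat[of _ n n _ n] add_mult_distrib_mat[of _ n n _ _ n])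
    then have "conj_pair n A' (Phi n p B)"
      unfolding conj_pair_def using P Q PQ QP
      by (intro exI[of _ P] exI[of _ Q])
        (simp add: A' B XY Phi_def mat_poly_eval_conj[OF Y P Q PQ QP])
    then show ?thesis
      unfolding gen_step_def by blast
  next
    assume A': "A' = Psi n p A"
    let ?E = "mat_poly_eval n (pderiv p) X"
    have E: "?E \<in> carrier_mat n n"
      by (rule mat_poly_eval_carrier[OF X])
    have "P * (Y - ?E) * Q = P * Y * Q - P * ?E * Q"
      using P Q Y E by (simp add: mult_minus_distrib_mat[of _ n n _ n] minus_mult_distrib_mat[of _ n n _ _ n])
    then have "conj_pair n A' (Psi n p B)"
      unfolding conj_pair_def using P Q PQ QP
      by (intro exI[of _ P] exI[of _ Q])
        (simp add: A' B XY Psi_def mat_poly_eval_conj[OF X P Q PQ QP])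
    then show ?thesis
      unfolding gen_step_def by blast
  qed
qed

lemma gen_steps_conj:
  assumes steps: "(gen_step n)\<^sup>*\<^sup>* A A'" and "conj_pair n A B" and A: "A \<in> mat_pairs n"
  shows "\<exists>B'. (gen_step n)\<^sup>*\<^sup>* B B' \<and> conj_pair n A' B'"
  using steps
proof (induction rule: rtranclp_induct)
  case base
  then show ?case
    using assms(2) by blast
next
  case (step C D)
  then obtain B' where B': "(gen_step n)\<^sup>*\<^sup>* B B'" "conj_pair n C B'"
    by blast
  have "C \<in> mat_pairs n"
    using gen_steps_sym[OF step.hyps(1) A] by simp
  from gen_step_conj[OF B'(2) this step.hyps(2)] show ?case
    using B'(1) by (meson rtranclp.rtrancl_into_rtrancl)
qed

lemma conj_pair_sym:
  assumes "conj_pair n A B" and A: "A \<in> mat_pairs n"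
  shows "conj_pair n B A"
proof -
  obtain P Q where P: "P \<in> carrier_mat n n" and Q: "Q \<in> carrier_mat n n"
    and PQ: "P * Q = 1\<^sub>m n" and QP: "Q * P = 1\<^sub>m n"
    and B: "fst B = P * fst A * Q" "snd B = P * snd A * Q"
    using assms by (auto simp: conj_pair_def)
  have "Q * (P * M * Q) * P = M" if M: "M \<in> carrier_mat n n" for M
  proof -
    have "Q * (P * M * Q) * P = (Q * P) * (M * (Q * P))"
      using P Q M by (simp add: assoc_mult_mat[of _ n n _ n _ n])
    then show ?thesis
      unfolding QP using M by simp
  qed
  then show ?thesis
    unfolding conj_pair_def using P Q PQ QP B A
    by (intro exI[of _ Q] exI[of _ P]) (auto simp: mat_pairs_def)
qed

lemma conj_pair_trans:
  assumes "conj_pair n A B" "conj_pair n B C" and A: "A \<in> mat_pairs n"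
  shows "conj_pair n A C"
proof -
  obtain P Q where P: "P \<in> carrier_mat n n" and Q: "Q \<in> carrier_mat n n"
    and PQ: "P * Q = 1\<^sub>m n" and QP: "Q * P = 1\<^sub>m n"
    and B: "fst B = P * fst A * Q" "snd B = P * snd A * Q"
    using assms by (auto simp: conj_pair_def)
  obtain P' Q' where P': "P' \<in> carrier_mat n n" and Q': "Q' \<in> carrier_mat n n"
    and PQ': "P' * Q' = 1\<^sub>m n" and QP': "Q' * P' = 1\<^sub>m n"
    and C: "fst C = P' * fst B * Q'" "snd C = P' * snd B * Q'"
    using assms by (auto simp: conj_pair_def)
  have eq: "P' * (P * M * Q) * Q' = (P' * P) * M * (Q * Q')" if "M \<in> carrier_mat n n" for M
    using P Q P' Q' that by (simp add: assoc_mult_mat[of _ n n _ n _ n])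
  have 1: "(P' * P) * (Q * Q') = 1\<^sub>m n"
  proof -
    have "(P' * P) * (Q * Q') = P' * ((P * Q) * Q')"
      using P Q P' Q' by (simp add: assoc_mult_mat[of _ n n _ n _ n])
    then show ?thesis
      unfolding PQ using Q' PQ' by simp
  qed
  have 2: "(Q * Q') * (P' * P) = 1\<^sub>m n"
  proof -
    have "(Q * Q') * (P' * P) = Q * ((Q' * P') * P)"
      using P Q P' Q' by (simp add: assoc_mult_mat[of _ n n _ n _ n])
    then show ?thesis
      unfolding QP' using P QP by simp
  qed
  show ?thesis
    unfolding conj_pair_def using P Q P' Q' 1 2 A
    by (intro exI[of _ "P' * P"] exI[of _ "Q * Q'"]) (auto simp: C B eq mat_pairs_def)
qed

theorem theorem1p3:
  fixes n :: nat
  assumes "A \<in> CM_pairs n" and "B \<in> CM_pairs n"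
  shows "\<exists>C. (gen_step n)\<^sup>*\<^sup>* A C \<and> conj_pair n C B"
proof -
  let ?Z = "(canonical_X n, canonical_Y n)"
  have A: "A \<in> mat_pairs n" and B: "B \<in> mat_pairs n"
    using assms by (auto simp: CM_pairs_def mat_pairs_def)
  have "\<exists>C. (gen_step n)\<^sup>*\<^sup>* S C \<and> conj_pair n C ?Z" if S: "S \<in> CM_pairs n" for S
  proof (cases S)
    case (Pair X Y)
    then obtain v w where "calogero_moser n X Y v w"
      using S CM_pairs_calogero_moser[of X Y n] by blast
    then show ?thesis
      unfolding Pair by (rule calogero_moser.reaches_canonical)
  qed
  from this[OF assms(1)] this[OF assms(2)] obtain C D
    where C: "(gen_step n)\<^sup>*\<^sup>* A C" "conj_pair n C ?Z"
      and D: "(gen_step n)\<^sup>*\<^sup>* B D" "conj_pair n D ?Z"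
    by blast
  have C': "C \<in> mat_pairs n" and D': "D \<in> mat_pairs n" and DB: "(gen_step n)\<^sup>*\<^sup>* D B"
    using gen_steps_sym[OF C(1) A] gen_steps_sym[OF D(1) B] by blast+
  \<comment> \<open>The two paths end at conjugates of the same canonical pair.\<close>
  have "conj_pair n D C"
    using D(2) conj_pair_sym[OF C(2) C'] D' by (rule conj_pair_trans)
  \<comment> \<open>The reversed path from \<open>D\<close> to \<open>B\<close> is copied at
    \<open>C\<close>, so that it continues the path from \<open>A\<close> and ends at a conjugate of
    \<open>B\<close>.\<close>
  from gen_steps_conj[OF DB this D'] obtain E where E: "(gen_step n)\<^sup>*\<^sup>* C E" "conj_pair n B E"
    by blast
  have "(gen_step n)\<^sup>*\<^sup>* A E"
    using C(1) E(1) by simp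
  then show ?thesis
    using conj_pair_sym[OF E(2) B] by blast
qed

end
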